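(* For every real number $\beta\in(1,2)$, the Bernoulli convolution $\mu_\beta$ satisfies $\dim(\mu_\beta)\ge 0.82$.
   Context: For real $\beta\in(1,2)$ put $I_\beta=[0,1/(\beta-1)]$. The Bernoulli convolution $\mu_\beta$ is the Borel probability measure on $I_\beta$ given by $$\mu_\beta(E)=\mathbb{P}\Bigl\{(a_1,a_2,\dots)\in\{0,1\}^{\mathbb{N}} : \sum_{k=1}^\infty a_k\beta^{-k}\in E\Bigr\}$$ for Borel $E\subseteq I_\beta$, where $\mathbb{P}$ is the product measure on $\{0,1\}^{\mathbb{N}}$ with $\mathbb{P}(a_1=0)=\mathbb{P}(a_1=1)=1/2$. It is known that $\mu_\beta$ is exact-dimensional: there is a number $\alpha$ such that $$\lim_{r\to0}\frac{\log\mu_\beta(x-r,x+r)}{\log r}=\alpha$$ for $\mu_\beta$-almost every $x$. This number $\alpha$ is denoted $\dim(\mu_\beta)$. *)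

theory Defs
  imports "HOL-Probability.Probability"
begin

text \<open>The fair coin-tossing measure on \<open>{0,1}\<close>-sequences; the digits 0 and 1 are encoded as
  \<open>False\<close> and \<open>True\<close>, and \<open>\<omega> k\<close> is the digit \<open>a\<close> with index \<open>k + 1\<close>.\<close>

definition coin_space :: "(nat \<Rightarrow> bool) measure" where
  "coin_space = (\<Pi>\<^sub>M k\<in>UNIV. measure_pmf (bernoulli_pmf (1/2)))"

definition digit_sum :: "real \<Rightarrow> (nat \<Rightarrow> bool) \<Rightarrow> real" where
  "digit_sum \<beta> \<omega> = (\<Sum>k. of_bool (\<omega> k) / \<beta> ^ Suc k)"

text \<open>The measure is taken on the Borel sets of the whole real line; it is concentrated on
  \<open>{0..1 / (\<beta> - 1)}\<close>, see \<open>AE_bernoulli_convolution\<close> below.\<close>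

definition bernoulli_convolution :: "real \<Rightarrow> real measure" where
  "bernoulli_convolution \<beta> = distr coin_space borel (digit_sum \<beta>)"

text \<open>For almost every \<open>x\<close> the ball has positive measure for all \<open>r > 0\<close>, so the convention
  \<open>ln 0 = 0\<close> plays no role.\<close>

definition has_exact_dim :: "real measure \<Rightarrow> real \<Rightarrow> bool" where
  "has_exact_dim \<mu> \<alpha> \<longleftrightarrow>
     (AE x in \<mu>. ((\<lambda>r. ln (measure \<mu> {x - r<..<x + r}) / ln r) \<longlongrightarrow> \<alpha>) (at_right 0))"

text \<open>This value is meaningful only for exact-dimensional measures. By \<open>exact_dim_eqI\<close> below
  it is then the exponent; otherwise it is an unspecified real, so a bound on it cannot be derived
  without exact-dimensionality.\<close>

definition exact_dim :: "real measure \<Rightarrow> real" where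
  "exact_dim \<mu> = (THE \<alpha>. has_exact_dim \<mu> \<alpha>)"

lemma prob_space_coin_space: "prob_space coin_space"
  unfolding coin_space_def by (intro prob_space_PiM prob_space_measure_pmf)

lemma measurable_digit_sum [measurable]: "digit_sum \<beta> \<in> borel_measurable coin_space"
proof -
  have [measurable]: "(\<lambda>\<omega>. \<omega> k) \<in> measurable coin_space (count_space UNIV)" for k
  proof -
    have "(\<lambda>\<omega>. \<omega> k) \<in> measurable coin_space (measure_pmf (bernoulli_pmf (1/2)))"
      unfolding coin_space_def by (rule measurable_component_singleton) simp
    then show ?thesis by simp
  qed
  show ?thesis unfolding digit_sum_def by measurable
qed

lemma prob_space_bernoulli_convolution: "prob_space (bernoulli_convolution \<beta>)"
  unfolding bernoulli_convolution_def
  by (rule prob_space.prob_space_distr[OF prob_space_coin_space]) measurable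

lemma digit_sum_bounds:
  assumes "1 < \<beta>"
  shows "digit_sum \<beta> \<omega> \<in> {0..1 / (\<beta> - 1)}"
proof -
  have g: "(\<lambda>k. 1 / \<beta> ^ Suc k) sums (1 / (\<beta> - 1))"
  proof -
    have "(\<lambda>k. (1/\<beta>) * (1/\<beta>) ^ k) sums ((1/\<beta>) * (1 / (1 - 1/\<beta>)))"
      using assms by (intro sums_mult geometric_sums) auto
    moreover have "(1/\<beta>) * (1 / (1 - 1/\<beta>)) = 1 / (\<beta> - 1)"
      using assms by (simp add: field_simps)
    ultimately show ?thesis by (simp add: power_one_over divide_inverse power_inverse)
  qed
  have le: "of_bool (\<omega> k) / \<beta> ^ Suc k \<le> 1 / \<beta> ^ Suc k" for k
    using assms by (intro divide_right_mono) auto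
  have s: "summable (\<lambda>k. of_bool (\<omega> k) / \<beta> ^ Suc k)"
    by (rule summable_comparison_test'[OF sums_summable[OF g], of 0])
      (use le assms in auto)
  have "digit_sum \<beta> \<omega> \<le> 1 / (\<beta> - 1)"
    unfolding digit_sum_def sums_unique[OF g]
    by (rule suminf_le[OF le s sums_summable[OF g]])
  moreover have "0 \<le> digit_sum \<beta> \<omega>"
    unfolding digit_sum_def by (rule suminf_nonneg[OF s]) (use assms in auto)
  ultimately show ?thesis by simp
qed

lemma AE_bernoulli_convolution:
  assumes "1 < \<beta>"
  shows "AE x in bernoulli_convolution \<beta>. x \<in> {0..1 / (\<beta> - 1)}"
  unfolding bernoulli_convolution_def
  by (subst AE_distr_iff) (use digit_sum_bounds[OF assms] in auto)

lemma exact_dim_eqI: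
  assumes "prob_space \<mu>" "has_exact_dim \<mu> \<alpha>"
  shows "exact_dim \<mu> = \<alpha>"
  unfolding exact_dim_def
proof (rule the_equality)
  fix \<alpha>' assume "has_exact_dim \<mu> \<alpha>'"
  with assms(2) have "AE x in \<mu>. \<alpha>' = \<alpha>"
    unfolding has_exact_dim_def
    by eventually_elim (rule tendsto_unique[OF trivial_limit_at_right_real])
  then show "\<alpha>' = \<alpha>"
    using prob_space.AE_const[OF assms(1)] by simp
qed (rule assms(2))

end

theory Submission
  imports Defs
begin

text \<open>The value \<open>exact_dim\<close> of the Bernoulli convolution \<open>\<mu>\<close> is meaningful only because \<open>\<mu>\<close> is
  exact-dimensional, so the theorem has two halves: a local dimension \<open>\<alpha>\<close> exists, and it is at
  least 0.82.

  \<^bold>\<open>Existence.\<close> Write \<open>x \<omega>\<close> for the digit sum and \<open>B\<^sub>n \<omega>\<close> for the ball of radius \<open>c / \<beta>\<^sup>n\<close> around it.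
  The image of \<open>\<mu>\<close> under \<open>y \<mapsto> (b + y) / \<beta>\<close>, called \<open>branch b\<close>, is the law of \<open>x\<close> given that the first
  digit is \<open>b\<close>. By scaling, \<open>branch (\<omega> 0)\<close> gives \<open>B\<^bsub>n+1\<^esub> \<omega>\<close> the mass that \<open>\<mu>\<close> gives to
  \<open>B\<^sub>n (shift \<omega>)\<close>. Hence \<open>ln (\<mu> (B\<^sub>n \<omega>))\<close> telescopes into a sum of logarithmic ratios
  \<open>ln (\<mu> (B\<^sub>m) / branch (B\<^sub>m))\<close>, taken at depth \<open>m = n - k\<close> along the orbit of the shift
  (\<open>ln_measure_ball_eq_sum\<close>). By differentiation of measures on the line these ratios
  converge almost surely as \<open>m \<rightarrow> \<infinity>\<close>, and by the maximal inequality their supremum has an exponential tail,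
  hence is integrable. Maker's extension of Birkhoff's ergodic theorem then makes \<open>ln (\<mu> (B\<^sub>n \<omega>)) / n\<close>
  converge to a constant, which is the required exponent up to the factor \<open>- ln \<beta>\<close>.

  \<^bold>\<open>Lower bound.\<close> By Fatou's lemma \<open>\<alpha> \<ge> s\<close> as soon as two independent points of \<open>\<mu>\<close> are within \<open>r\<close> of each
  other with probability \<open>O(r\<^sup>s)\<close> (\<open>exact_dim_lower_bound_by_correlation\<close>). The difference of the two
  points is driven by the random walk \<open>y \<mapsto> \<beta> y + \<epsilon>\<close>, where \<open>\<epsilon>\<close> is \<open>-1, 0, 1\<close> with probabilities 1/4, 1/2, 1/4,
  and the points are within a multiple of \<open>\<beta>\<^sup>-\<^sup>n\<close> only if the walk stays bounded for \<open>n\<close> steps. A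
  nonnegative function \<open>\<psi>\<close> of bounded support that is at least 1 on the interval from which the walk can
  stay bounded, and whose average over a step is at most \<open>\<rho> \<psi>\<close>, bounds this probability by a multiple of
  \<open>\<rho>\<^sup>n\<close>, and \<open>\<rho> \<le> \<beta> powr -0.82\<close> is what is needed. Seven integer-valued step functions serve all
  \<open>\<beta> \<in> [1.41, 2]\<close>, because a step function that is even and nonincreasing in \<open>\<bar>y\<bar>\<close> can be checked for a
  whole interval of parameters at once by integer arithmetic. For smaller \<open>\<beta>\<close> one squares: splitting the
  digits into even and odd places exhibits \<open>\<mu>\<^sub>\<beta>\<close> as a convolution with a factor \<open>\<mu>\<^bsub>\<beta>\<^sup>2\<^esub>\<close>, and convolution
  worsens the probability of closeness at most by a constant (\<open>near_le_twice_near_zero\<close>).\<close>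

section \<open>Ergodic theorems\<close>

locale ergodic_map = prob_space M for M :: "'a measure" +
  fixes T :: "'a \<Rightarrow> 'a"
  assumes measurable_T [measurable]: "T \<in> measurable M M"
    and distr_T: "distr M M T = M"
    and ergodic: "A \<in> sets M \<Longrightarrow> T -` A \<inter> space M = A \<Longrightarrow> prob A = 0 \<or> prob A = 1"
begin

lemma measurable_T_power [measurable]: "T ^^ k \<in> measurable M M"
  by (induction k) (auto intro: measurable_comp[of _ M M _ M] simp: comp_def)

lemma distr_T_power: "distr M M (T ^^ k) = M"
proof (induction k)
  case (Suc k)
  have "distr M M (T ^^ Suc k) = distr (distr M M (T ^^ k)) M T"
    by (subst distr_distr) (auto simp: comp_def)
  then show ?case unfolding Suc distr_T .
qed (simp add: id_def distr_id)

lemma T_in_space: "x \<in> space M \<Longrightarrow> T x \<in> space M"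
  using measurable_T by (rule measurable_space)

lemma AE_T:
  assumes "AE x in M. P x"
  shows "AE x in M. P (T x)"
proof -
  have "AE x in distr M M T. P x" using assms unfolding distr_T .
  then show ?thesis by (rule AE_distrD[OF measurable_T])
qed

lemma AE_T_power:
  assumes "AE x in M. P x"
  shows "AE x in M. \<forall>k. P ((T ^^ k) x)"
proof (subst AE_all_countable, rule allI)
  fix k
  have "AE x in distr M M (T ^^ k). P x" using assms unfolding distr_T_power .
  then show "AE x in M. P ((T ^^ k) x)" by (rule AE_distrD[OF measurable_T_power])
qed

lemma integrable_T:
  fixes f :: "'a \<Rightarrow> real"
  assumes "integrable M f"
  shows "integrable M (\<lambda>x. f (T x))" "(\<integral>x. f (T x) \<partial>M) = integral\<^sup>L M f"
proof -
  have f: "f \<in> borel_measurable M" using assms by auto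
  have "integrable (distr M M T) f" using assms unfolding distr_T .
  then show "integrable M (\<lambda>x. f (T x))"
    by (subst (asm) integrable_distr_eq) (use f in auto)
  have "integral\<^sup>L (distr M M T) f = (\<integral>x. f (T x) \<partial>M)"
    by (subst integral_distr) (use f in auto)
  then show "(\<integral>x. f (T x) \<partial>M) = integral\<^sup>L M f" unfolding distr_T by simp
qed

text \<open>The maximum of the Birkhoff sums of lengths \<open>0, \<dots>, n\<close>, in the recursive form on which the proof of
  the ergodic theorem rests.\<close>
primrec max_sum :: "('a \<Rightarrow> real) \<Rightarrow> nat \<Rightarrow> 'a \<Rightarrow> real" where
  "max_sum f 0 x = 0"
| "max_sum f (Suc n) x = max 0 (f x + max_sum f n (T x))"

lemma max_sum_nonneg: "0 \<le> max_sum f n x"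
  by (cases n) auto

lemma max_sum_Suc_ge: "max_sum f n x \<le> max_sum f (Suc n) x"
proof (induction n arbitrary: x)
  case (Suc n)
  show ?case using Suc.IH[of "T x"] by (simp del: max_sum.simps add: max_sum.simps(2)[of f n x] max_sum.simps(2)[of f "Suc n" x])
qed simp

lemma sum_le_max_sum: "(\<Sum>k<n. f ((T ^^ k) x)) \<le> max_sum f n x"
proof (induction n arbitrary: x)
  case (Suc n)
  have "(\<Sum>k<Suc n. f ((T ^^ k) x)) = f x + (\<Sum>k<n. f ((T ^^ k) (T x)))"
    by (subst sum.lessThan_Suc_shift) (simp add: funpow_swap1)
  then show ?case using Suc.IH[of "T x"] by simp
qed simp

lemma integrable_max_sum:
  assumes "integrable M f"
  shows "integrable M (max_sum f n)"
proof (induction n)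
  case (Suc n)
  then show ?case using assms integrable_T(1)[OF Suc] by simp
qed simp

text \<open>The maximal sums satisfy \<open>max_sum f (Suc n) - max_sum f n \<circ> T = max (- max_sum f n \<circ> T) f\<close>, whose
  integral is nonnegative because \<open>T\<close> preserves the measure and \<open>max_sum f n\<close> grows with \<open>n\<close>. On the
  invariant set where the maximal sums are unbounded the right-hand side decreases to \<open>f\<close>. If that set
  had full measure, dominated convergence would give \<open>\<integral> f \<ge> 0\<close>; hence it is null.\<close>
lemma max_sum_bounded:
  assumes f: "integrable M f" and neg: "integral\<^sup>L M f < 0"
  shows "AE x in M. \<exists>K::nat. \<forall>n. max_sum f n x \<le> K"
proof -
  have [measurable]: "f \<in> borel_measurable M" using f by auto
  have [measurable]: "max_sum f n \<in> borel_measurable M" for n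
    using integrable_max_sum[OF f] by auto
  define A where "A = {x \<in> space M. \<forall>K::nat. \<exists>n. max_sum f n x > K}"
  have A_sets: "A \<in> sets M" unfolding A_def by measurable
  have "T -` A \<inter> space M = A"
  proof (intro set_eqI iffI)
    fix x assume "x \<in> T -` A \<inter> space M"
    then have x: "x \<in> space M" and *: "\<And>K::nat. \<exists>n. max_sum f n (T x) > K" by (auto simp: A_def)
    have "\<exists>n. max_sum f n x > real K" for K
    proof -
      obtain N :: nat where N: "real K - f x \<le> N" using real_arch_simple by blast
      obtain n where "max_sum f n (T x) > N" using * by blast
      then have "max_sum f (Suc n) x > K" using N by simp
      then show ?thesis by blast
    qed
    then show "x \<in> A" using x by (auto simp: A_def)
  next
    fix x assume "x \<in> A"
    then have x: "x \<in> space M" and *: "\<And>K::nat. \<exists>n. max_sum f n x > K" by (auto simp: A_def)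
    have "\<exists>n. max_sum f n (T x) > real K" for K
    proof -
      obtain N :: nat where N: "real K + \<bar>f x\<bar> \<le> N" using real_arch_simple by blast
      obtain n where n: "max_sum f n x > N" using * by blast
      then obtain m where "n = Suc m" using N by (cases n) auto
      then have "max_sum f m (T x) > K" using n N by (auto simp: max_def split: if_splits)
      then show ?thesis by blast
    qed
    then show "x \<in> T -` A \<inter> space M" using x by (auto simp: A_def T_in_space)
  qed
  then consider "prob A = 0" | "prob A = 1" using ergodic A_sets by blast
  then show ?thesis
  proof cases
    case 1
    then have "AE x in M. x \<notin> A" using A_sets by (simp add: prob_eq_0)
    then show ?thesis by (rule AE_mp) (auto simp: A_def not_less)
  next
    case 2
    define D where "D n x = max_sum f (Suc n) x - max_sum f n (T x)" for n x
    have [measurable]: "D n \<in> borel_measurable M" for n unfolding D_def by measurable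
    have D: "D n x = max (- max_sum f n (T x)) (f x)" for n x
      by (auto simp: D_def max_def)
    have "AE x in M. x \<in> A" using 2 by (rule AE_prob_1)
    then have "AE x in M. T x \<in> A" by (rule AE_T)
    then have lim: "AE x in M. (\<lambda>n. D n x) \<longlonglongrightarrow> f x"
    proof eventually_elim
      case (elim x)
      obtain N :: nat where N: "- f x \<le> N" using real_arch_simple by blast
      obtain n0 where n0: "max_sum f n0 (T x) > N" using elim by (auto simp: A_def)
      have "max_sum f n (T x) \<ge> max_sum f n0 (T x)" if "n \<ge> n0" for n
        using lift_Suc_mono_le[of "\<lambda>n. max_sum f n (T x)", OF max_sum_Suc_ge that] .
      then have "D n x = f x" if "n \<ge> n0" for n
        using that n0 N unfolding D by (force simp: max_def)
      then show ?case by (intro tendsto_eventually eventually_sequentiallyI[of n0])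
    qed
    have "(\<lambda>n. integral\<^sup>L M (D n)) \<longlonglongrightarrow> integral\<^sup>L M f"
    proof (rule integral_dominated_convergence[where w="\<lambda>x. \<bar>f x\<bar>"])
      show "AE x in M. norm (D n x) \<le> \<bar>f x\<bar>" for n
      proof (intro AE_I2)
        fix x show "norm (D n x) \<le> \<bar>f x\<bar>"
          using max_sum_nonneg[of f n "T x"] by (auto simp: D max_def)
      qed
    qed (use f lim in auto)
    moreover have "integral\<^sup>L M (D n) \<ge> 0" for n
    proof -
      have "integral\<^sup>L M (D n) = integral\<^sup>L M (max_sum f (Suc n)) - integral\<^sup>L M (max_sum f n)"
        unfolding D_def
        using integrable_max_sum[OF f] integrable_T[OF integrable_max_sum[OF f, of n]]
        by (subst Bochner_Integration.integral_diff) (auto simp del: max_sum.simps)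
      moreover have "integral\<^sup>L M (max_sum f n) \<le> integral\<^sup>L M (max_sum f (Suc n))"
        by (intro integral_mono integrable_max_sum f max_sum_Suc_ge)
      ultimately show ?thesis by simp
    qed
    ultimately have "integral\<^sup>L M f \<ge> 0" by (intro LIMSEQ_le_const) auto
    then show ?thesis using neg by simp
  qed
qed

text \<open>The upper half of Birkhoff's theorem, by \<open>max_sum_bounded\<close> for \<open>f - \<integral> f - e\<close>. The lower half is this
  statement for \<open>- f\<close>.\<close>
lemma birkhoff_upper:
  assumes f: "integrable M f"
  shows "AE x in M. \<forall>e>0. \<forall>\<^sub>F n in sequentially. (\<Sum>k<n. f ((T ^^ k) x)) \<le> real n * (integral\<^sup>L M f + e)"
proof -
  have "AE x in M. \<forall>j. \<forall>\<^sub>F n in sequentially.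
      (\<Sum>k<n. f ((T ^^ k) x)) \<le> real n * (integral\<^sup>L M f + (1 / Suc j + 1 / Suc j))"
  proof (subst AE_all_countable, rule allI)
    fix j :: nat
    define c where "c = integral\<^sup>L M f + 1 / Suc j"
    have "AE x in M. \<exists>K::nat. \<forall>n. max_sum (\<lambda>x. f x - c) n x \<le> K"
      using f by (intro max_sum_bounded) (auto simp: c_def prob_space)
    then show "AE x in M. \<forall>\<^sub>F n in sequentially.
        (\<Sum>k<n. f ((T ^^ k) x)) \<le> real n * (integral\<^sup>L M f + (1 / Suc j + 1 / Suc j))"
    proof eventually_elim
      case (elim x)
      then obtain K :: nat where K: "\<And>n. max_sum (\<lambda>x. f x - c) n x \<le> K" by blast
      show ?case
      proof (rule eventually_sequentiallyI[of "K * Suc j"])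
        fix n assume n: "n \<ge> K * Suc j"
        have "real K * Suc j \<le> n" using n by (metis of_nat_le_iff of_nat_mult)
        then have "real K \<le> n * (1 / Suc j)" by (simp add: field_simps)
        moreover have "(\<Sum>k<n. f ((T ^^ k) x)) - n * c \<le> K"
          using sum_le_max_sum[of "\<lambda>x. f x - c" x n] K[of n] by (simp add: sum_subtractf)
        ultimately show "(\<Sum>k<n. f ((T ^^ k) x)) \<le> real n * (integral\<^sup>L M f + (1 / Suc j + 1 / Suc j))"
          unfolding c_def by (simp add: distrib_left)
      qed
    qed
  qed
  then show ?thesis
  proof eventually_elim
    case (elim x)
    show ?case
    proof (intro allI impI)
      fix e :: real assume "e > 0"
      then obtain j where j: "1 / real (Suc j) < e / 2" using nat_approx_posE[of "e/2"] by auto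
      show "\<forall>\<^sub>F n in sequentially. (\<Sum>k<n. f ((T ^^ k) x)) \<le> real n * (integral\<^sup>L M f + e)"
        using elim[rule_format, of j]
      proof eventually_elim
        case (elim n)
        have "real n * (integral\<^sup>L M f + (1 / Suc j + 1 / Suc j)) \<le> real n * (integral\<^sup>L M f + e)"
          using j by (intro mult_left_mono) auto
        then show ?case using elim by linarith
      qed
    qed
  qed
qed

text \<open>Maker's theorem: the summand may depend on its distance \<open>n - k\<close> to the end of the orbit segment. With
  \<open>h N = sup {\<bar>F m - f\<bar>. m \<ge> N}\<close>, all but the last \<open>N\<close> terms are within \<open>h N\<close> of \<open>f\<close>, whose
  averages tend to \<open>\<integral> h N\<close>, which is small; the last \<open>N\<close> terms are within \<open>h 0\<close>, and a window of fixed length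
  at the end of an orbit segment is negligible on average, since the averages of \<open>h 0\<close> converge.\<close>
lemma maker_ergodic_theorem:
  fixes f :: "'a \<Rightarrow> real" and F :: "nat \<Rightarrow> 'a \<Rightarrow> real"
  assumes F [measurable]: "\<And>n. F n \<in> borel_measurable M"
    and f: "integrable M f" and G: "integrable M G"
    and lim: "AE x in M. (\<lambda>n. F n x) \<longlonglongrightarrow> f x"
    and dom: "AE x in M. \<forall>n. \<bar>F n x - f x\<bar> \<le> G x"
  shows "AE x in M. (\<lambda>n. (\<Sum>k<n. F (n - k) ((T ^^ k) x)) / n) \<longlonglongrightarrow> integral\<^sup>L M f"
proof -
  have [measurable]: "f \<in> borel_measurable M" "G \<in> borel_measurable M" using f G by auto
  \<comment> \<open>The supremum is taken in \<open>ennreal\<close> because the family is bounded only almost everywhere.\<close>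
  define h where "h N x = enn2real (SUP n. ennreal \<bar>F (N + n) x - f x\<bar>)" for N x
  have [measurable]: "h N \<in> borel_measurable M" for N unfolding h_def by measurable
  have h_nonneg: "0 \<le> h N x" for N x by (simp add: h_def)
  have SUP_fin: "(SUP n. ennreal \<bar>F (N + n) x - f x\<bar>) \<le> ennreal c"
    if "\<And>n. n \<ge> N \<Longrightarrow> \<bar>F n x - f x\<bar> \<le> c" for N x c
    using that by (intro SUP_least ennreal_leI) auto
  have h_le: "h N x \<le> c" if "\<And>n. n \<ge> N \<Longrightarrow> \<bar>F n x - f x\<bar> \<le> c" for N x c
  proof -
    have "0 \<le> c" using that[of N] by auto
    then show ?thesis unfolding h_def
      using enn2real_mono[OF SUP_fin[of N x c, OF that]] by simp
  qed
  have h_ge: "\<bar>F n x - f x\<bar> \<le> h N x" if "\<And>n. \<bar>F n x - f x\<bar> \<le> G x" "n \<ge> N" for n N x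
  proof -
    have "(SUP n. ennreal \<bar>F (N + n) x - f x\<bar>) < \<top>"
      using SUP_fin[of N x "G x"] that(1) by (meson ennreal_less_top le_less_trans)
    moreover have "ennreal \<bar>F (N + (n - N)) x - f x\<bar> \<le> (SUP n. ennreal \<bar>F (N + n) x - f x\<bar>)"
      by (rule SUP_upper) simp
    ultimately have "enn2real (ennreal \<bar>F n x - f x\<bar>) \<le> h N x"
      unfolding h_def using that(2) by (intro enn2real_mono) auto
    then show ?thesis by simp
  qed
  have h_G: "AE x in M. norm (h N x) \<le> G x" for N
    using dom by eventually_elim (use h_le h_nonneg in auto)
  have h_int: "integrable M (h N)" for N
    by (rule Bochner_Integration.integrable_bound[OF G]) (use h_G[of N] in \<open>auto elim: eventually_mono\<close>)
  have "(\<lambda>N. integral\<^sup>L M (h N)) \<longlonglongrightarrow> integral\<^sup>L M (\<lambda>_. 0)"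
  proof (rule integral_dominated_convergence[OF _ _ G])
    show "AE x in M. (\<lambda>N. h N x) \<longlonglongrightarrow> 0"
      using lim
    proof eventually_elim
      case (elim x)
      show ?case
      proof (rule LIMSEQ_I)
        fix r :: real assume "r > 0"
        then obtain N0 where "\<And>n. n \<ge> N0 \<Longrightarrow> \<bar>F n x - f x\<bar> < r / 2"
          using LIMSEQ_D[OF elim, of "r/2"] by auto
        then have "h N x \<le> r / 2" if "N \<ge> N0" for N
          using that by (intro h_le) (auto intro: less_imp_le)
        then show "\<exists>N0. \<forall>N\<ge>N0. norm (h N x - 0) < r"
          using \<open>r > 0\<close> h_nonneg by (intro exI[of _ N0]) fastforce
      qed
    qed
  qed (use h_G in auto)
  then have h_lim: "(\<lambda>N. integral\<^sup>L M (h N)) \<longlonglongrightarrow> 0" by simp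

  note upper = birkhoff_upper[OF f] birkhoff_upper[of "\<lambda>x. - f x"] birkhoff_upper[OF h_int]
  have "AE x in M. \<forall>N. \<forall>e>0. \<forall>\<^sub>F n in sequentially. (\<Sum>k<n. h N ((T ^^ k) x)) \<le> real n * (integral\<^sup>L M (h N) + e)"
    using upper(3) by (subst AE_all_countable) auto
  moreover note upper(1)
  moreover have "AE x in M. \<forall>e>0. \<forall>\<^sub>F n in sequentially. (\<Sum>k<n. - f ((T ^^ k) x)) \<le> real n * (- integral\<^sup>L M f + e)"
    using upper(2) f by simp
  moreover have "AE x in M. \<forall>e>0. \<forall>\<^sub>F n in sequentially. (\<Sum>k<n. - h 0 ((T ^^ k) x)) \<le> real n * (- integral\<^sup>L M (h 0) + e)"
    using birkhoff_upper[of "\<lambda>x. - h 0 x"] h_int by simp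
  moreover note AE_T_power[OF dom]
  ultimately show ?thesis
  proof eventually_elim
    case (elim x)
    note h_up = elim(1)[rule_format] and f_up = elim(2)[rule_format] and f_low = elim(3)[rule_format]
      and h_low = elim(4)[rule_format] and d = elim(5)
    define S where "S n = (\<Sum>k<n. F (n - k) ((T ^^ k) x))" for n
    let ?c = "integral\<^sup>L M f"
    show ?case unfolding S_def[symmetric]
    proof (rule LIMSEQ_I)
      fix r :: real assume r: "r > 0"
      then obtain N where "norm (integral\<^sup>L M (h N) - 0) < r / 8" using LIMSEQ_D[OF h_lim, of "r/8"] by auto
      then have N: "integral\<^sup>L M (h N) < r / 8" by auto
      define c0 where "c0 = integral\<^sup>L M (h 0)"
      have c0: "c0 \<ge> 0" using h_nonneg by (simp add: c0_def integral_nonneg)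
      have r8: "r / 8 > 0" using r by simp
      define W where "W n = (\<Sum>k<n. h 0 ((T ^^ k) x))" for n
      have W: "\<forall>\<^sub>F n in sequentially. W (n - N) \<ge> real (n - N) * (c0 - r / 8)"
      proof -
        have "\<forall>\<^sub>F n in sequentially. W n \<ge> real n * (c0 - r / 8)"
          using h_low[OF r8] by eventually_elim (simp add: W_def c0_def sum_negf algebra_simps)
        then show ?thesis by (rule eventually_compose_filterlim) (rule filterlim_minus_const_nat_at_top)
      qed
      have "\<forall>\<^sub>F n in sequentially. real N * (c0 + r/8) \<le> real n * (r / 8)"
      proof -
        obtain n0 :: nat where "real N * (c0 + r/8) / (r/8) \<le> n0" using real_arch_simple by blast
        then have "real N * (c0 + r/8) \<le> real n0 * (r/8)" using r8 by (simp add: pos_divide_le_eq)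
        then show ?thesis using r8
          by (intro eventually_sequentiallyI[of n0]) (meson less_imp_le mult_right_mono of_nat_mono order_trans)
      qed
      then have "\<forall>\<^sub>F n in sequentially. norm (S n / n - ?c) < r"
        using h_up[OF r8, of N] f_up[OF r8] f_low[OF r8] W h_up[OF r8, of 0]
          eventually_ge_at_top[of "Suc N"]
      proof eventually_elim
        case (elim n)
        have n: "n > 0" "n \<ge> N" using elim by auto
        have "\<bar>S n - (\<Sum>k<n. f ((T ^^ k) x))\<bar> \<le> (\<Sum>k<n. \<bar>F (n - k) ((T ^^ k) x) - f ((T ^^ k) x)\<bar>)"
          unfolding S_def by (simp add: sum_subtractf[symmetric])
        also have "\<dots> = (\<Sum>k<n-N. \<bar>F (n - k) ((T ^^ k) x) - f ((T ^^ k) x)\<bar>)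
              + (\<Sum>k\<in>{n-N..<n}. \<bar>F (n - k) ((T ^^ k) x) - f ((T ^^ k) x)\<bar>)"
          by (subst sum.union_disjoint[symmetric]) (auto intro: sum.cong)
        also have "\<dots> \<le> (\<Sum>k<n-N. h N ((T ^^ k) x)) + (\<Sum>k\<in>{n-N..<n}. h 0 ((T ^^ k) x))"
          using d by (intro add_mono sum_mono h_ge) auto
        also have "(\<Sum>k<n-N. h N ((T ^^ k) x)) \<le> (\<Sum>k<n. h N ((T ^^ k) x))"
          by (intro sum_mono2) (auto simp: h_nonneg)
        also have "(\<Sum>k\<in>{n-N..<n}. h 0 ((T ^^ k) x)) = W n - W (n - N)"
        proof -
          have "W n = W (n - N) + (\<Sum>k\<in>{n-N..<n}. h 0 ((T ^^ k) x))"
            unfolding W_def by (subst sum.union_disjoint[symmetric]) (auto intro: sum.cong)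
          then show ?thesis by simp
        qed
        finally have 1: "\<bar>S n - (\<Sum>k<n. f ((T ^^ k) x))\<bar> \<le> n * (r/8 + r/8) + W n - W (n - N)"
          using elim(2) mult_left_mono[of "integral\<^sup>L M (h N) + r/8" "r/8 + r/8" "real n"] N by linarith
        have 2: "W n \<le> n * (c0 + r / 8)" using elim(6) by (simp add: W_def c0_def)
        have 3: "real (n - N) * (c0 - r / 8) = n * (c0 - r/8) - N * (c0 - r/8)"
          using n by (simp add: of_nat_diff left_diff_distrib)
        have "N * (c0 - r/8) \<le> N * (c0 + r/8)" using r by (intro mult_left_mono) auto
        then have "W n - W (n - N) \<le> n * (3 * r / 8)"
          using 2 3 elim(1,5) by (simp add: algebra_simps)
        then have "\<bar>S n - (\<Sum>k<n. f ((T ^^ k) x))\<bar> \<le> n * (5 * r / 8)" using 1 by (simp add: algebra_simps)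
        moreover have "\<bar>(\<Sum>k<n. f ((T ^^ k) x)) - n * ?c\<bar> \<le> n * (r / 8)"
          using elim(3,4) unfolding abs_le_iff distrib_left sum_negf by simp
        ultimately have "\<bar>S n - n * ?c\<bar> \<le> n * (5 * r / 8) + n * (r / 8)" by linarith
        also have "\<dots> = n * (6 * r / 8)" by (simp add: field_simps)
        finally have "\<bar>S n - n * ?c\<bar> \<le> n * (6 * r / 8)" .
        moreover have "S n / n - ?c = (S n - n * ?c) / n" using n by (simp add: field_simps)
        ultimately have "\<bar>S n / n - ?c\<bar> \<le> 6 * r / 8" using n by (simp add: pos_divide_le_eq mult.commute)
        then show ?case using r by simp
      qed
      then show "\<exists>n0. \<forall>n\<ge>n0. norm (S n / n - ?c) < r" by (simp add: eventually_sequentially)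
    qed
  qed
qed

end

section \<open>The coin-tossing space and digit sums\<close>
abbreviation fair_coin :: "bool measure" where
  "fair_coin \<equiv> measure_pmf (bernoulli_pmf (1/2))"

definition shift :: "(nat \<Rightarrow> 'a) \<Rightarrow> nat \<Rightarrow> 'a" where
  "shift \<omega> n = \<omega> (Suc n)"

definition interleave :: "(nat \<Rightarrow> 'a) \<Rightarrow> (nat \<Rightarrow> 'a) \<Rightarrow> nat \<Rightarrow> 'a" where
  "interleave \<omega> \<eta> n = (if odd n then \<omega> (n div 2) else \<eta> (n div 2))"

interpretation coins: sequence_space fair_coin
  by (simp add: sequence_space_def product_prob_space_def product_sigma_finite_def
      product_prob_space_axioms_def prob_space_measure_pmf prob_space_imp_sigma_finite)

interpretation coin: prob_space coin_space
  by (rule prob_space_coin_space)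

interpretation coin_pair: pair_prob_space coin_space coin_space ..

lemma space_coin_space [simp]: "space coin_space = UNIV"
  by (simp add: coin_space_def space_PiM)

lemma measurable_coordinate [measurable]: "(\<lambda>\<omega>. \<omega> k) \<in> measurable coin_space (count_space UNIV)"
proof -
  have "(\<lambda>\<omega>. \<omega> k) \<in> measurable coin_space fair_coin"
    unfolding coin_space_def by (rule measurable_component_singleton) simp
  then show ?thesis by simp
qed

lemma measurable_into_coin_space:
  assumes "\<And>k. (\<lambda>x. f x k) \<in> measurable N (count_space UNIV)"
  shows "f \<in> measurable N coin_space"
  unfolding coin_space_def
  by (rule measurable_PiM_single') (use assms in \<open>auto simp: measurable_pmf_measure2\<close>)

lemma sets_cylinder:
  assumes "finite J"
  shows "{\<omega>. \<forall>j\<in>J. \<omega> j \<in> E j} \<in> sets coin_space"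
proof -
  have "{\<omega> \<in> space coin_space. \<forall>j\<in>J. \<omega> j \<in> E j} \<in> sets coin_space"
    using assms by measurable
  then show ?thesis by simp
qed

lemma emeasure_cylinder:
  assumes "finite J"
  shows "emeasure coin_space {\<omega>. \<forall>j\<in>J. \<omega> j \<in> E j} = (\<Prod>j\<in>J. emeasure fair_coin (E j))"
  using coins.emeasure_PiM_Collect[of J E] assms
  by (simp add: coin_space_def[symmetric])

lemma coin_space_eqI:
  assumes "sets N = sets coin_space"
    and "\<And>J E. finite J \<Longrightarrow> emeasure N {\<omega>. \<forall>j\<in>J. \<omega> j \<in> E j} = (\<Prod>j\<in>J. emeasure fair_coin (E j))"
  shows "N = coin_space"
  unfolding coin_space_def
proof (rule coins.PiM_eq)
  fix J :: "nat set" and E :: "nat \<Rightarrow> bool set"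
  assume "finite J"
  moreover have "prod_emb UNIV (\<lambda>_. fair_coin) J (Pi\<^sub>E J E) = {\<omega>. \<forall>j\<in>J. \<omega> j \<in> E j}"
    by (auto simp: prod_emb_def)
  ultimately show "emeasure N (prod_emb UNIV (\<lambda>_. fair_coin) J (Pi\<^sub>E J E)) = (\<Prod>j\<in>J. emeasure fair_coin (E j))"
    using assms(2) by simp
qed (use assms(1) in \<open>simp add: coin_space_def\<close>)

lemma measurable_shift [measurable]: "shift \<in> measurable coin_space coin_space"
  by (rule measurable_into_coin_space) (simp add: shift_def)

lemma measurable_case_nat_coin [measurable]: "case_nat b \<in> measurable coin_space coin_space"
  by (rule measurable_into_coin_space) (auto split: nat.split)

lemma measurable_interleave [measurable]:
  "(\<lambda>(\<omega>, \<eta>). interleave \<omega> \<eta>) \<in> measurable (coin_space \<Otimes>\<^sub>M coin_space) coin_space"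
  by (rule measurable_into_coin_space) (auto simp: interleave_def split_beta')

lemma nn_integral_coin_space_first:
  assumes [measurable]: "f \<in> borel_measurable coin_space"
  shows "(\<integral>\<^sup>+\<omega>. f \<omega> \<partial>coin_space) =
    (1/2) * (\<integral>\<^sup>+\<omega>. f (case_nat True \<omega>) \<partial>coin_space) + (1/2) * (\<integral>\<^sup>+\<omega>. f (case_nat False \<omega>) \<partial>coin_space)"
proof -
  have [measurable]: "(\<lambda>(s, \<omega>). case_nat s \<omega>) \<in> measurable (fair_coin \<Otimes>\<^sub>M coin_space) coin_space"
    by (rule measurable_into_coin_space) (auto simp: split_beta' split: nat.split)
  have "(\<integral>\<^sup>+\<omega>. f \<omega> \<partial>coin_space) =
      (\<integral>\<^sup>+\<omega>. f \<omega> \<partial>distr (fair_coin \<Otimes>\<^sub>M coin_space) coin_space (\<lambda>(s, \<omega>). case_nat s \<omega>))"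
    using coins.PiM_iter by (simp add: coin_space_def)
  also have "\<dots> = (\<integral>\<^sup>+p. f (case_nat (fst p) (snd p)) \<partial>(fair_coin \<Otimes>\<^sub>M coin_space))"
    by (subst nn_integral_distr) (auto simp: split_beta')
  also have "\<dots> = (\<integral>\<^sup>+b. (\<integral>\<^sup>+\<omega>. f (case_nat b \<omega>) \<partial>coin_space) \<partial>fair_coin)"
    by (subst coin.nn_integral_fst[symmetric]) (auto simp: split_beta')
  also have "\<dots> = (1/2) * (\<integral>\<^sup>+\<omega>. f (case_nat True \<omega>) \<partial>coin_space) + (1/2) * (\<integral>\<^sup>+\<omega>. f (case_nat False \<omega>) \<partial>coin_space)"
    by (simp add: nn_integral_bernoulli_pmf mult.commute ennreal_divide_numeral flip: ennreal_1)
  finally show ?thesis .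
qed

lemma distr_shift: "distr coin_space coin_space shift = coin_space"
  using distr_PiM_reindex[of UNIV "\<lambda>_. fair_coin" Suc UNIV]
  by (simp add: coin_space_def shift_def[abs_def] prob_space_measure_pmf restrict_def)

lemma shift_power: "(shift ^^ k) \<omega> n = \<omega> (n + k)"
  by (induction k arbitrary: n) (auto simp: shift_def)

text \<open>An invariant event \<open>A\<close> is determined by the digits beyond any place, hence is independent of every cylinder.
  Conditioning on \<open>A\<close> therefore leaves the coin measure unchanged, and conditioned on \<open>A\<close> the
  event \<open>A\<close> has probability 1.\<close>
lemma coin_space_zero_one:
  assumes A: "A \<in> sets coin_space" and inv: "shift -` A = A"
  shows "coin.prob A = 0 \<or> coin.prob A = 1"
proof (rule disjCI)
  assume "coin.prob A \<noteq> 1"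
  show "coin.prob A = 0"
  proof (rule ccontr)
    let ?a = "emeasure coin_space A"
    assume "coin.prob A \<noteq> 0"
    then have a: "?a \<noteq> 0" "?a \<noteq> \<top>" by (auto simp: coin.emeasure_eq_measure)
    have inv_power: "(shift ^^ i) \<omega> \<in> A \<longleftrightarrow> \<omega> \<in> A" for i \<omega>
      using inv by (induction i) auto
    have indep: "emeasure coin_space ({\<omega>. \<forall>j\<in>J. \<omega> j \<in> E j} \<inter> A) = (\<Prod>j\<in>J. emeasure fair_coin (E j)) * ?a"
      if J: "finite J" for J E
    proof -
      obtain i where i: "\<And>j. j \<in> J \<Longrightarrow> j < i" using J by (meson finite_nat_set_iff_bounded)
      let ?C = "{\<omega>. \<forall>j\<in>J. \<omega> j \<in> E j}"
      have [measurable]: "?C \<in> sets coin_space" "A \<in> sets coin_space" using sets_cylinder[OF J] A by auto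
      have m: "(\<lambda>(\<omega>, \<omega>'). comb_seq i \<omega> \<omega>') \<in> measurable (coin_space \<Otimes>\<^sub>M coin_space) coin_space"
        unfolding coin_space_def by (rule measurable_comb_seq)
      have "comb_seq i \<omega> \<omega>' \<in> ?C \<inter> A \<longleftrightarrow> \<omega> \<in> ?C \<and> \<omega>' \<in> A" for \<omega> \<omega>'
      proof -
        have "(shift ^^ i) (comb_seq i \<omega> \<omega>') = \<omega>'"
          by (auto simp: shift_power comb_seq_add)
        then have "comb_seq i \<omega> \<omega>' \<in> A \<longleftrightarrow> \<omega>' \<in> A" using inv_power by metis
        then show ?thesis using i by (auto simp: comb_seq_less)
      qed
      then have "(\<lambda>(\<omega>, \<omega>'). comb_seq i \<omega> \<omega>') -` (?C \<inter> A) = ?C \<times> A"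
        by (intro set_eqI) (simp only: vimage_eq mem_Times_iff split_beta)
      moreover have "distr (coin_space \<Otimes>\<^sub>M coin_space) coin_space (\<lambda>(\<omega>, \<omega>'). comb_seq i \<omega> \<omega>') = coin_space"
        unfolding coin_space_def by (rule coins.PiM_comb_seq)
      ultimately have "emeasure coin_space (?C \<inter> A) = emeasure (coin_space \<Otimes>\<^sub>M coin_space) (?C \<times> A)"
        using emeasure_distr[OF m, of "?C \<inter> A"] by (simp add: space_pair_measure)
      also have "\<dots> = emeasure coin_space ?C * ?a"
        by (rule coin.emeasure_pair_measure_Times) measurable
      finally show ?thesis by (simp add: emeasure_cylinder[OF J])
    qed
    let ?N = "density coin_space (\<lambda>\<omega>. indicator A \<omega> / ?a)"
    have N: "emeasure ?N C = emeasure coin_space (C \<inter> A) / ?a" if [measurable]: "C \<in> sets coin_space" for C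
    proof -
      have "emeasure ?N C = (\<integral>\<^sup>+\<omega>. indicator (C \<inter> A) \<omega> / ?a \<partial>coin_space)"
        using A by (subst emeasure_density) (auto intro!: nn_integral_cong split: split_indicator)
      then show ?thesis using A by (simp add: nn_integral_divide)
    qed
    have "?N = coin_space"
    proof (rule coin_space_eqI)
      fix J :: "nat set" and E :: "nat \<Rightarrow> bool set" assume J: "finite J"
      show "emeasure ?N {\<omega>. \<forall>j\<in>J. \<omega> j \<in> E j} = (\<Prod>j\<in>J. emeasure fair_coin (E j))"
        unfolding N[OF sets_cylinder[OF J]] indep[OF J] using a by (simp add: ennreal_mult_divide_eq)
    qed simp
    then have "?a = ?a / ?a" using N[OF A] by simp
    then have "?a = 1" using a by (metis ennreal_divide_self less_top)
    then show False using \<open>coin.prob A \<noteq> 1\<close> by (simp add: coin.emeasure_eq_measure)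
  qed
qed

interpretation coin: ergodic_map coin_space shift
  by unfold_locales (use distr_shift coin_space_zero_one in auto)

lemma distr_interleave:
  "distr (coin_space \<Otimes>\<^sub>M coin_space) coin_space (\<lambda>(\<omega>, \<eta>). interleave \<omega> \<eta>) = coin_space"
proof (rule coin_space_eqI)
  fix J :: "nat set" and E :: "nat \<Rightarrow> bool set" assume J: "finite J"
  define Od where "Od = (\<lambda>j. 2 * j + 1) -` J"
  define Ev where "Ev = (\<lambda>j. 2 * j) -` J"
  have fin: "finite Od" "finite Ev"
    unfolding Od_def Ev_def using J by (auto intro!: finite_vimageI inj_onI)
  have J_eq: "J = (\<lambda>j. 2 * j + 1) ` Od \<union> (\<lambda>j. 2 * j) ` Ev"
  proof (intro set_eqI iffI)
    fix j assume "j \<in> J"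
    then show "j \<in> (\<lambda>j. 2 * j + 1) ` Od \<union> (\<lambda>j. 2 * j) ` Ev"
      by (cases "even j") (auto simp: Od_def Ev_def elim!: evenE oddE)
  qed (auto simp: Od_def Ev_def)
  have "interleave \<omega> \<eta> \<in> {\<omega>. \<forall>j\<in>J. \<omega> j \<in> E j} \<longleftrightarrow>
      \<omega> \<in> {\<omega>. \<forall>j\<in>Od. \<omega> j \<in> E (2 * j + 1)} \<and> \<eta> \<in> {\<omega>. \<forall>j\<in>Ev. \<omega> j \<in> E (2 * j)}" for \<omega> \<eta>
    unfolding J_eq by (auto simp: interleave_def ball_Un)
  then have "(\<lambda>(\<omega>, \<eta>). interleave \<omega> \<eta>) -` {\<omega>. \<forall>j\<in>J. \<omega> j \<in> E j} =
      {\<omega>. \<forall>j\<in>Od. \<omega> j \<in> E (2 * j + 1)} \<times> {\<omega>. \<forall>j\<in>Ev. \<omega> j \<in> E (2 * j)}"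
    by (intro set_eqI) (simp only: vimage_eq mem_Times_iff split_beta)
  then have "emeasure (distr (coin_space \<Otimes>\<^sub>M coin_space) coin_space (\<lambda>(\<omega>, \<eta>). interleave \<omega> \<eta>)) {\<omega>. \<forall>j\<in>J. \<omega> j \<in> E j}
     = emeasure (coin_space \<Otimes>\<^sub>M coin_space) ({\<omega>. \<forall>j\<in>Od. \<omega> j \<in> E (2 * j + 1)} \<times> {\<omega>. \<forall>j\<in>Ev. \<omega> j \<in> E (2 * j)})"
    using sets_cylinder[OF J] by (subst emeasure_distr) (auto simp: space_pair_measure)
  also have "\<dots> = emeasure coin_space {\<omega>. \<forall>j\<in>Od. \<omega> j \<in> E (2 * j + 1)} * emeasure coin_space {\<omega>. \<forall>j\<in>Ev. \<omega> j \<in> E (2 * j)}"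
    by (rule coin.emeasure_pair_measure_Times) (rule sets_cylinder[OF fin(1)], rule sets_cylinder[OF fin(2)])
  also have "\<dots> = (\<Prod>j\<in>Od. emeasure fair_coin (E (2 * j + 1))) * (\<Prod>j\<in>Ev. emeasure fair_coin (E (2 * j)))"
    using emeasure_cylinder[OF fin(1), of "\<lambda>j. E (2 * j + 1)"] emeasure_cylinder[OF fin(2), of "\<lambda>j. E (2 * j)"] by simp
  also have "\<dots> = (\<Prod>j\<in>J. emeasure fair_coin (E j))"
    unfolding J_eq using fin
    by (subst prod.union_disjoint) (auto simp: prod.reindex inj_on_def, presburger)
  finally show "emeasure (distr (coin_space \<Otimes>\<^sub>M coin_space) coin_space (\<lambda>(\<omega>, \<eta>). interleave \<omega> \<eta>)) {\<omega>. \<forall>j\<in>J. \<omega> j \<in> E j}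
     = (\<Prod>j\<in>J. emeasure fair_coin (E j))" .
qed simp

lemma summable_digit_sum:
  assumes "1 < \<beta>"
  shows "summable (\<lambda>k. of_bool (\<omega> k) / \<beta> ^ Suc k :: real)"
proof (rule summable_comparison_test'[where N=0])
  show "summable (\<lambda>k. (1 / \<beta>) ^ Suc k)"
    using assms by (subst summable_Suc_iff) (intro summable_geometric, simp)
  show "norm (of_bool (\<omega> k) / \<beta> ^ Suc k) \<le> (1 / \<beta>) ^ Suc k" for k
    using assms by (auto simp: power_one_over divide_simps)
qed

lemma digit_sum_unfold:
  assumes "1 < \<beta>"
  shows "digit_sum \<beta> \<omega> = (of_bool (\<omega> 0) + digit_sum \<beta> (shift \<omega>)) / \<beta>"
proof -
  have "digit_sum \<beta> \<omega> = (\<Sum>k. of_bool (\<omega> (Suc k)) / \<beta> ^ Suc (Suc k)) + of_bool (\<omega> 0) / \<beta>"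
    unfolding digit_sum_def using suminf_split_head[OF summable_digit_sum[OF assms, of \<omega>]] by simp
  also have "(\<Sum>k. of_bool (\<omega> (Suc k)) / \<beta> ^ Suc (Suc k)) = (\<Sum>k. of_bool (shift \<omega> k) / \<beta> ^ Suc k / \<beta>)"
    by (simp add: shift_def field_simps)
  also have "\<dots> = digit_sum \<beta> (shift \<omega>) / \<beta>"
    unfolding digit_sum_def by (rule suminf_divide[OF summable_digit_sum[OF assms]])
  finally show ?thesis by (simp add: add_divide_distrib)
qed

lemma digit_sum_case_nat:
  assumes "1 < \<beta>"
  shows "digit_sum \<beta> (case_nat b \<omega>) = (of_bool b + digit_sum \<beta> \<omega>) / \<beta>"
  using digit_sum_unfold[OF assms, of "case_nat b \<omega>"] by (simp add: shift_def[abs_def])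

text \<open>The reason to put \<open>\<omega>\<close> at the odd places: counting digits from 0, an odd place \<open>2 j + 1\<close> has weight
  \<open>\<beta> ^ -(2 j + 2) = (\<beta>\<^sup>2) ^ -(j + 1)\<close>, so \<open>\<omega>\<close> contributes exactly its digit sum in base \<open>\<beta>\<^sup>2\<close>.\<close>
lemma digit_sum_interleave:
  assumes "1 < \<beta>"
  shows "digit_sum \<beta> (interleave \<omega> \<eta>) = digit_sum (\<beta>\<^sup>2) \<omega> + \<beta> * digit_sum (\<beta>\<^sup>2) \<eta>"
proof -
  have b2: "1 < \<beta>\<^sup>2" using assms by (simp add: one_less_power)
  note sums = summable_sums[OF summable_digit_sum[OF b2]]
  have "(\<lambda>n. if even n then \<beta> * (of_bool (\<eta> (n div 2)) / (\<beta>\<^sup>2) ^ Suc (n div 2))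
      else of_bool (\<omega> ((n - 1) div 2)) / (\<beta>\<^sup>2) ^ Suc ((n - 1) div 2)) sums
      (digit_sum (\<beta>\<^sup>2) \<omega> + \<beta> * digit_sum (\<beta>\<^sup>2) \<eta>)"
    unfolding digit_sum_def by (intro sums_if sums_mult sums)
  also have "(\<lambda>n. if even n then \<beta> * (of_bool (\<eta> (n div 2)) / (\<beta>\<^sup>2) ^ Suc (n div 2))
      else of_bool (\<omega> ((n - 1) div 2)) / (\<beta>\<^sup>2) ^ Suc ((n - 1) div 2)) =
      (\<lambda>n. of_bool (interleave \<omega> \<eta> n) / \<beta> ^ Suc n)"
  proof
    fix n
    show "(if even n then \<beta> * (of_bool (\<eta> (n div 2)) / (\<beta>\<^sup>2) ^ Suc (n div 2))
      else of_bool (\<omega> ((n - 1) div 2)) / (\<beta>\<^sup>2) ^ Suc ((n - 1) div 2)) = of_bool (interleave \<omega> \<eta> n) / \<beta> ^ Suc n"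
      using assms
    proof (cases "even n")
      case True
      then obtain m where "n = 2 * m" by (rule evenE)
      then show ?thesis using assms by (simp add: interleave_def power_mult) (simp add: power2_eq_square)
    next
      case False
      then obtain m where "n = 2 * m + 1" by (rule oddE)
      then show ?thesis using assms by (simp add: interleave_def power_mult) (simp add: power2_eq_square)
    qed
  qed
  finally show ?thesis unfolding digit_sum_def[of \<beta>] by (rule sums_unique[symmetric])
qed

section \<open>Differentiation of measures on the line\<close>
text \<open>In a subfamily of least size with the same union no point lies in three intervals: of three intervals with a
  common point, the one reaching furthest left and the one reaching furthest right cover the third.\<close>
lemma finite_ball_cover_overlap_two:
  fixes F :: "(real \<times> real) set"
  assumes "finite F"
  shows "\<exists>G\<subseteq>F. (\<Union>(x, r)\<in>G. ball x r) = (\<Union>(x, r)\<in>F. ball x r) \<and>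
    (\<forall>y. card {(x, r) \<in> G. y \<in> ball x r} \<le> 2)"
proof -
  let ?U = "\<lambda>G. \<Union>(x, r)\<in>G. ball (x :: real) r"
  define G where "G = (ARG_MIN card G. G \<subseteq> F \<and> ?U G = ?U F)"
  have G: "G \<subseteq> F" "?U G = ?U F"
    and G_min: "\<And>H. H \<subseteq> F \<Longrightarrow> ?U H = ?U F \<Longrightarrow> card G \<le> card H"
    using arg_min_nat_lemma[of "\<lambda>G. G \<subseteq> F \<and> ?U G = ?U F" F card] by (auto simp: G_def)
  have fin: "finite G" using G(1) assms finite_subset by blast
  have "card {(x, r) \<in> G. y \<in> ball x r} \<le> 2" for y
  proof (rule ccontr)
    let ?H = "{(x, r) \<in> G. y \<in> ball x r}"
    assume "\<not> card ?H \<le> 2"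
    then have card: "card ?H \<ge> 3" by simp
    have finH: "finite ?H" using fin by (rule rev_finite_subset) auto
    have neH: "?H \<noteq> {}" using card by (intro notI) (simp only: card.empty)
    obtain l where l: "l \<in> ?H" "\<And>p. p \<in> ?H \<Longrightarrow> fst l - snd l \<le> fst p - snd p"
      using ex_min_if_finite[of "(\<lambda>p. fst p - snd p) ` ?H"] finH neH
      by (metis (no_types, lifting) arg_min_if_finite(1) arg_min_least)
    obtain u where u: "u \<in> ?H" "\<And>p. p \<in> ?H \<Longrightarrow> fst p + snd p \<le> fst u + snd u"
      using arg_min_if_finite(1)[OF finH neH, of "\<lambda>p. - (fst p + snd p)"]
        arg_min_least[OF finH neH, of _ "\<lambda>p. - (fst p + snd p)"] by fastforce
    have "card {l, u} \<le> 2" by (simp add: card_insert_if)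
    then have "\<not> ?H \<subseteq> {l, u}" using card card_mono[of "{l, u}" ?H] by fastforce
    then obtain p where p: "p \<in> ?H" "p \<noteq> l" "p \<noteq> u" by blast
    have sub: "ball (fst p) (snd p) \<subseteq> ball (fst l) (snd l) \<union> ball (fst u) (snd u)"
    proof
      fix z assume "z \<in> ball (fst p) (snd p)"
      moreover have "y \<in> ball (fst l) (snd l)" "y \<in> ball (fst u) (snd u)" using l(1) u(1) by auto
      ultimately show "z \<in> ball (fst l) (snd l) \<union> ball (fst u) (snd u)"
        using l(2)[OF p(1)] u(2)[OF p(1)] by (auto simp: dist_real_def abs_less_iff)
    qed
    have "?U (G - {p}) = ?U G"
    proof
      show "?U G \<subseteq> ?U (G - {p})"
      proof
        fix z assume "z \<in> ?U G"
        then obtain q where q: "q \<in> G" "z \<in> ball (fst q) (snd q)" by auto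
        have lu: "l \<in> G - {p}" "u \<in> G - {p}" using l(1) u(1) p by auto
        obtain q' where "q' \<in> G - {p}" "z \<in> ball (fst q') (snd q')"
          using q sub lu by (cases "q = p") blast+
        then show "z \<in> ?U (G - {p})" by (auto simp: case_prod_beta)
      qed
    qed auto
    then have "card G \<le> card (G - {p})" using G by (intro G_min) auto
    moreover have "card (G - {p}) < card G" using p(1) fin by (intro card_Diff1_less) auto
    ultimately show False by simp
  qed
  then show ?thesis using G by blast
qed

text \<open>Unlike the Vitali covering lemma, the covering with overlap two needs no enlargement of the balls, so the
  inequality holds for every finite measure on the line. Inner regularity reduces to compact sets, where finitely many balls
  suffice.\<close>
lemma maximal_inequality:
  fixes \<mu> \<nu> :: "real measure"
  assumes \<mu>: "finite_measure \<mu>" "sets \<mu> = sets borel" and \<nu>: "finite_measure \<nu>" "sets \<nu> = sets borel"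
    and E: "E \<in> sets borel" and c: "0 \<le> c"
    and large: "\<And>x. x \<in> E \<Longrightarrow> \<exists>r>0. c * measure \<mu> (ball x r) \<le> measure \<nu> (ball x r)"
  shows "c * measure \<mu> E \<le> 2 * measure \<nu> UNIV"
proof -
  interpret \<mu>: finite_measure \<mu> by fact
  interpret \<nu>: finite_measure \<nu> by fact
  note [simp] = \<mu>(2) \<nu>(2)
  have space: "space \<mu> = UNIV" "space \<nu> = UNIV" using sets_eq_imp_space_eq[OF \<mu>(2)] sets_eq_imp_space_eq[OF \<nu>(2)] by simp_all
  have compact: "c * measure \<mu> K \<le> 2 * measure \<nu> UNIV" if K: "K \<subseteq> E" "compact K" for K
  proof -
    have "\<forall>x\<in>K. \<exists>r>0. c * measure \<mu> (ball x r) \<le> measure \<nu> (ball x r)" using large K by blast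
    then obtain R where R: "\<And>x. x \<in> K \<Longrightarrow> 0 < R x \<and> c * measure \<mu> (ball x (R x)) \<le> measure \<nu> (ball x (R x))"
      by metis
    obtain C where C: "C \<subseteq> K" "finite C" "K \<subseteq> (\<Union>x\<in>C. ball x (R x))"
      using compactE_image[OF K(2), of K "\<lambda>x. ball x (R x)"] R by force
    define F where "F = (\<lambda>x. (x, R x)) ` C"
    have "finite F" using C by (simp add: F_def)
    then have "\<exists>G\<subseteq>F. (\<Union>(x, r)\<in>G. ball x r) = (\<Union>(x, r)\<in>F. ball x r) \<and>
      (\<forall>y. card {(x, r) \<in> G. y \<in> ball x r} \<le> 2)" by (rule finite_ball_cover_overlap_two)
    then obtain G where G: "G \<subseteq> F" "(\<Union>(x, r)\<in>G. ball x r) = (\<Union>(x, r)\<in>F. ball x r)"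
      "\<And>y. card {(x, r) \<in> G. y \<in> ball x r} \<le> 2" by blast
    have finG: "finite G" using G(1) \<open>finite F\<close> finite_subset by blast
    let ?B = "\<lambda>p. ball (fst p) (snd p) :: real set"
    have "K \<subseteq> (\<Union>p\<in>G. ?B p)" using C(3) G(2) by (auto simp: F_def case_prod_beta)
    then have "measure \<mu> K \<le> measure \<mu> (\<Union>p\<in>G. ?B p)"
      using finG by (intro \<mu>.finite_measure_mono) auto
    also have "\<dots> \<le> (\<Sum>p\<in>G. measure \<mu> (?B p))"
      using finG by (intro measure_UNION_le) auto
    finally have "c * measure \<mu> K \<le> (\<Sum>p\<in>G. c * measure \<mu> (?B p))"
      using c by (simp add: sum_distrib_left[symmetric] mult_left_mono)
    also have "\<dots> \<le> (\<Sum>p\<in>G. measure \<nu> (?B p))"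
    proof (rule sum_mono)
      fix p assume "p \<in> G"
      then obtain x where "x \<in> C" "p = (x, R x)" using G(1) by (auto simp: F_def)
      then show "c * measure \<mu> (?B p) \<le> measure \<nu> (?B p)" using C(1) R by auto
    qed
    also have "\<dots> = (\<Sum>p\<in>G. \<integral>y. indicator (?B p) y \<partial>\<nu>)" by (simp add: space)
    also have "\<dots> = (\<integral>y. (\<Sum>p\<in>G. indicator (?B p) y) \<partial>\<nu>)"
      by (subst Bochner_Integration.integral_sum) (auto simp: \<nu>.emeasure_finite less_top[symmetric])
    also have "\<dots> \<le> (\<integral>y. 2 \<partial>\<nu>)"
    proof (rule integral_mono)
      fix y
      have "(\<Sum>p\<in>G. indicator (?B p) y :: real) = card {p\<in>G. y \<in> ?B p}"
        using finG by (simp add: indicator_def sum.If_cases Int_def)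
      also have "{p\<in>G. y \<in> ?B p} = {(x, r) \<in> G. y \<in> ball x r}" by auto
      also have "real (card {(x, r) \<in> G. y \<in> ball x r}) \<le> 2" using G(3)[of y] by simp
      finally show "(\<Sum>p\<in>G. indicator (?B p) y :: real) \<le> 2" .
    qed (auto simp: \<nu>.emeasure_finite less_top[symmetric])
    finally show ?thesis by (simp add: space)
  qed
  have "emeasure \<mu> E = (SUP K \<in> {K. K \<subseteq> E \<and> compact K}. emeasure \<mu> K)"
    using E by (intro inner_regular) auto
  then have "ennreal c * emeasure \<mu> E = (SUP K \<in> {K. K \<subseteq> E \<and> compact K}. ennreal c * emeasure \<mu> K)"
    by (simp add: SUP_mult_left_ennreal)
  also have "\<dots> \<le> ennreal (2 * measure \<nu> UNIV)"
    using compact c by (intro SUP_least) (auto simp: \<mu>.emeasure_eq_measure ennreal_mult[symmetric] intro!: ennreal_leI)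
  finally show ?thesis using c by (simp add: \<mu>.emeasure_eq_measure ennreal_mult[symmetric])
qed

lemma measurable_measure_ball [measurable]:
  fixes \<mu> :: "real measure"
  assumes \<mu>: "finite_measure \<mu>" "sets \<mu> = sets borel" and S: "S \<in> sets borel"
  shows "(\<lambda>x. measure \<mu> (S \<inter> ball x r)) \<in> borel_measurable borel"
proof -
  interpret finite_measure \<mu> by fact
  have [measurable_cong]: "sets \<mu> = sets borel" by fact
  note [measurable] = S
  have "{p \<in> space (borel \<Otimes>\<^sub>M borel). snd p \<in> S \<and> dist (fst p) (snd p) < r} \<in> sets (borel \<Otimes>\<^sub>M (borel :: real measure))"
    by measurable
  then have "{p :: real \<times> real. snd p \<in> S \<and> dist (fst p) (snd p) < r} \<in> sets (borel \<Otimes>\<^sub>M \<mu>)"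
    by (simp add: space_pair_measure sets_pair_measure_cong[OF refl \<mu>(2)])
  from measurable_emeasure_Pair[OF this] show ?thesis
    by (simp add: measure_def vimage_def ball_def Int_def)
qed

text \<open>Enclose \<open>A\<close> in an open \<open>U\<close> of almost the same measure. Small balls around points of \<open>A\<close> stay inside \<open>U\<close>, so
  what they have outside \<open>A\<close> lies in \<open>U - A\<close>, and the maximal inequality applies with the small
  measure \<open>\<mu>\<close> restricted to \<open>U - A\<close>.\<close>
lemma AE_density_point:
  fixes \<mu> :: "real measure"
  assumes \<mu>: "finite_measure \<mu>" "sets \<mu> = sets borel" and A: "A \<in> sets borel"
    and r: "\<And>n. 0 < r n" "r \<longlonglongrightarrow> 0"
  shows "AE x in \<mu>. x \<in> A \<longrightarrow> (\<lambda>n. measure \<mu> (ball x (r n) - A) / measure \<mu> (ball x (r n))) \<longlonglongrightarrow> 0"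
proof -
  interpret finite_measure \<mu> by fact
  have [measurable_cong, simp]: "sets \<mu> = sets borel" by fact
  have space: "space \<mu> = UNIV" using sets_eq_imp_space_eq[OF \<mu>(2)] by simp
  have [measurable]: "(\<lambda>x. measure \<mu> (ball x r)) \<in> borel_measurable borel" for r
    using measurable_measure_ball[OF \<mu>, of UNIV] by simp
  have [measurable]: "(\<lambda>x. measure \<mu> (ball x r - A)) \<in> borel_measurable borel" for r
    using measurable_measure_ball[OF \<mu>, of "- A" r] A by (simp add: Diff_eq Int_commute)
  note [measurable] = A
  have "AE x in \<mu>. \<forall>j. x \<in> A \<longrightarrow> (\<forall>\<^sub>F n in sequentially.
      measure \<mu> (ball x (r n) - A) \<le> 1 / real (Suc j) * measure \<mu> (ball x (r n)))"
    unfolding AE_all_countable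
  proof
    fix j :: nat
    let ?c = "1 / real (Suc j)"
    define N where "N = {x \<in> space borel. x \<in> A \<and> \<not> (\<forall>\<^sub>F n in sequentially.
      measure \<mu> (ball x (r n) - A) \<le> ?c * measure \<mu> (ball x (r n)))}"
    have N: "N \<in> sets borel" unfolding N_def by measurable
    have "?c * measure \<mu> N \<le> 2 * e" if "e > 0" for e
    proof -
      have "emeasure \<mu> A = (INF U \<in> {U. A \<subseteq> U \<and> open U}. emeasure \<mu> U)"
        using A by (intro outer_regular) auto
      moreover have "emeasure \<mu> A < emeasure \<mu> A + ennreal e"
        using \<open>e > 0\<close> by (simp add: emeasure_eq_measure ennreal_plus[symmetric] ennreal_less_iff del: ennreal_plus)
      ultimately obtain U where U: "A \<subseteq> U" "open U" "emeasure \<mu> U < emeasure \<mu> A + ennreal e"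
        by (auto simp: INF_less_iff)
      have [measurable]: "U \<in> sets borel" using U by auto
      let ?\<nu> = "density \<mu> (indicator (U - A))"
      have \<nu>: "measure ?\<nu> X = measure \<mu> ((U - A) \<inter> X)" if "X \<in> sets borel" for X
        using that by (intro measure_restricted) auto
      have UA: "measure \<mu> (U - A) \<le> e"
      proof -
        have "measure \<mu> (U - A) = measure \<mu> U - measure \<mu> A"
          using U(1) by (intro finite_measure_Diff) auto
        moreover have "measure \<mu> U < measure \<mu> A + e"
          using U(3) \<open>e > 0\<close> by (simp add: emeasure_eq_measure ennreal_plus[symmetric] ennreal_less_iff del: ennreal_plus)
        ultimately show ?thesis by simp
      qed
      have "?c * measure \<mu> N \<le> 2 * measure ?\<nu> UNIV"
      proof (rule maximal_inequality[OF \<mu> _ _ N])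
        show "finite_measure ?\<nu>"
          by (rule finite_measureI) (simp add: emeasure_restricted space emeasure_eq_measure)
        fix x assume "x \<in> N"
        then have x: "x \<in> A" and ne: "\<not> (\<forall>\<^sub>F n in sequentially.
            measure \<mu> (ball x (r n) - A) \<le> ?c * measure \<mu> (ball x (r n)))" by (auto simp: N_def)
        obtain \<delta> where \<delta>: "\<delta> > 0" "ball x \<delta> \<subseteq> U" using U x openE by blast
        have "\<forall>\<^sub>F n in sequentially. r n < \<delta>" using order_tendstoD(2)[OF r(2) \<delta>(1)] .
        with ne obtain n where n: "r n < \<delta>" "measure \<mu> (ball x (r n) - A) > ?c * measure \<mu> (ball x (r n))"
          by (metis (mono_tags, lifting) eventually_mono not_le)
        have "ball x (r n) \<subseteq> U" using n(1) \<delta>(2) by (meson less_imp_le order_trans subset_ball)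
        then have "ball x (r n) - A = (U - A) \<inter> ball x (r n)" by blast
        then show "\<exists>r>0. ?c * measure \<mu> (ball x r) \<le> measure ?\<nu> (ball x r)"
          using n(2) r(1) by (intro exI[of _ "r n"]) (auto simp: \<nu>)
      qed auto
      then show ?thesis using UA by (simp add: \<nu>)
    qed
    then have "?c * measure \<mu> N \<le> 0"
      using field_le_epsilon[of "?c * measure \<mu> N" 0] by (metis add_0 half_gt_zero mult_2 field_sum_of_halves)
    then have "measure \<mu> N = 0" by (simp add: divide_le_0_iff measure_le_0_iff)
    then have "N \<in> null_sets \<mu>" using N by (simp add: null_sets_def emeasure_eq_measure)
    then have "AE x in \<mu>. x \<notin> N" by (rule AE_not_in)
    then show "AE x in \<mu>. x \<in> A \<longrightarrow> (\<forall>\<^sub>F n in sequentially.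
      measure \<mu> (ball x (r n) - A) \<le> ?c * measure \<mu> (ball x (r n)))"
      by eventually_elim (auto simp: N_def)
  qed
  then show ?thesis
  proof eventually_elim
    case (elim x)
    show ?case
    proof
      assume "x \<in> A"
      note ev = elim[rule_format, OF \<open>x \<in> A\<close>]
      show "(\<lambda>n. measure \<mu> (ball x (r n) - A) / measure \<mu> (ball x (r n))) \<longlonglongrightarrow> 0"
      proof (rule tendstoI)
        fix e :: real assume "e > 0"
        then obtain j where j: "1 / real (Suc j) < e" using nat_approx_posE by auto
        from ev[of j] show "\<forall>\<^sub>F n in sequentially. dist (measure \<mu> (ball x (r n) - A) / measure \<mu> (ball x (r n))) 0 < e"
        proof eventually_elim
          case (elim n)
          show ?case
          proof (cases "measure \<mu> (ball x (r n)) = 0")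
            case False
            then have "measure \<mu> (ball x (r n)) > 0" by (simp add: zero_less_measure_iff)
            then have "measure \<mu> (ball x (r n) - A) / measure \<mu> (ball x (r n)) \<le> 1 / real (Suc j)"
              using elim by (simp add: pos_divide_le_eq)
            then show ?thesis using j by simp
          qed (use \<open>e > 0\<close> in simp)
        qed
      qed
    qed
  qed
qed

text \<open>The maximal inequality against the zero measure.\<close>
lemma AE_measure_ball_pos:
  fixes \<mu> :: "real measure"
  assumes \<mu>: "finite_measure \<mu>" "sets \<mu> = sets borel" and r: "\<And>n::nat. 0 < r n"
  shows "AE x in \<mu>. \<forall>n. measure \<mu> (ball x (r n)) > 0"
  unfolding AE_all_countable
proof
  interpret finite_measure \<mu> by fact
  fix n
  have [measurable]: "(\<lambda>x. measure \<mu> (ball x r)) \<in> borel_measurable borel" for r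
    using measurable_measure_ball[OF \<mu>, of UNIV] by simp
  define E where "E = {x \<in> space borel. measure \<mu> (ball x (r n)) = 0}"
  have E: "E \<in> sets borel" unfolding E_def by measurable
  have "1 * measure \<mu> E \<le> 2 * measure (null_measure borel :: real measure) UNIV"
  proof (rule maximal_inequality[OF \<mu> _ _ E])
    fix x assume "x \<in> E"
    then show "\<exists>r>0. 1 * measure \<mu> (ball x r) \<le> measure (null_measure borel :: real measure) (ball x r)"
      using r[of n] by (intro exI[of _ "r n"]) (simp add: E_def)
  qed (auto intro!: finite_measureI)
  then have "measure \<mu> E = 0" by (simp add: measure_le_0_iff)
  then have "E \<in> null_sets \<mu>" using E \<mu>(2) by (simp add: null_sets_def emeasure_eq_measure)
  then have "AE x in \<mu>. x \<notin> E" by (rule AE_not_in)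
  then show "AE x in \<mu>. measure \<mu> (ball x (r n)) > 0"
    by eventually_elim (auto simp: E_def zero_less_measure_iff)
qed

text \<open>Cut the range of \<open>d\<close> into levels of height \<open>1 / Suc N\<close>. Almost every \<open>x\<close> is a density point of its own
  level set, on which \<open>d\<close> differs from \<open>d x\<close> by at most \<open>1 / Suc N\<close>.\<close>
lemma lebesgue_differentiation:
  fixes \<mu> :: "real measure" and d :: "real \<Rightarrow> real"
  assumes \<mu>: "finite_measure \<mu>" "sets \<mu> = sets borel"
    and d [measurable]: "d \<in> borel_measurable borel" and d01: "\<And>x. 0 \<le> d x" "\<And>x. d x \<le> 1"
    and r: "\<And>n. 0 < r n" "r \<longlonglongrightarrow> 0"
  shows "AE x in \<mu>. (\<lambda>n. (\<integral>y. indicator (ball x (r n)) y * d y \<partial>\<mu>) / measure \<mu> (ball x (r n))) \<longlonglongrightarrow> d x"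
proof -
  interpret finite_measure \<mu> by fact
  have [measurable_cong, simp]: "sets \<mu> = sets borel" by fact
  have space: "space \<mu> = UNIV" using sets_eq_imp_space_eq[OF \<mu>(2)] by simp
  define A where "A N j = {y. \<lfloor>real (Suc N) * d y\<rfloor> = j}" for N :: nat and j :: int
  have [measurable]: "A N j \<in> sets borel" for N j
  proof -
    have "{y \<in> space borel. \<lfloor>real (Suc N) * d y\<rfloor> = j} \<in> sets borel" by measurable
    then show ?thesis by (simp add: A_def)
  qed
  have "AE x in \<mu>. \<forall>N j. x \<in> A N j \<longrightarrow>
      (\<lambda>n. measure \<mu> (ball x (r n) - A N j) / measure \<mu> (ball x (r n))) \<longlonglongrightarrow> 0"
    unfolding AE_all_countable using AE_density_point[OF \<mu> _ r] by simp
  then show ?thesis using AE_measure_ball_pos[OF \<mu>, of r, OF r(1)]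
  proof eventually_elim
    case (elim x)
    let ?m = "\<lambda>n. measure \<mu> (ball x (r n))"
    let ?I = "\<lambda>n. \<integral>y. indicator (ball x (r n)) y * d y \<partial>\<mu>"
    show ?case
    proof (rule tendstoI)
      fix e :: real assume "e > 0"
      then obtain N where N: "1 / real (Suc N) < e / 2" using nat_approx_posE[of "e/2"] by auto
      define j where "j = \<lfloor>real (Suc N) * d x\<rfloor>"
      have xA: "x \<in> A N j" by (simp add: A_def j_def)
      have "\<forall>\<^sub>F n in sequentially. measure \<mu> (ball x (r n) - A N j) / ?m n < e / 2"
        using elim(1) xA \<open>e > 0\<close> by (intro order_tendstoD(2)[of _ 0]) auto
      then show "\<forall>\<^sub>F n in sequentially. dist (?I n / ?m n) (d x) < e"
      proof eventually_elim
        case (elim n)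
        have m: "?m n > 0" using \<open>\<forall>n. 0 < ?m n\<close> by blast
        let ?B = "ball x (r n)"
        have int [simp]: "integrable \<mu> (indicator X :: real \<Rightarrow> real)" if "X \<in> sets borel" for X
          using that by (simp add: less_top[symmetric])
        have intd: "integrable \<mu> (\<lambda>y. indicator ?B y * d y)"
          using d01 by (intro integrable_const_bound[of _ 1]) (auto intro!: AE_I2 simp: indicator_def)
        have "?I n - d x * ?m n = (\<integral>y. indicator ?B y * d y - d x * indicator ?B y \<partial>\<mu>)"
          using intd by (subst Bochner_Integration.integral_diff) (auto simp: space)
        also have "\<bar>\<dots>\<bar> \<le> (\<integral>y. \<bar>indicator ?B y * d y - d x * indicator ?B y\<bar> \<partial>\<mu>)"
          by (rule integral_abs_bound)
        also have "\<dots> \<le> (\<integral>y. 1 / real (Suc N) * indicator ?B y + indicator (?B - A N j) y \<partial>\<mu>)"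
        proof (rule integral_mono)
          fix y
          have dd: "\<bar>d y - d x\<bar> \<le> 1" using d01[of x] d01[of y] by (simp add: abs_le_iff)
          have "\<bar>d y - d x\<bar> \<le> 1 / real (Suc N)" if "y \<in> A N j"
          proof -
            have "\<lfloor>real (Suc N) * d y\<rfloor> = \<lfloor>real (Suc N) * d x\<rfloor>" using that by (simp add: A_def j_def)
            then have "\<bar>real (Suc N) * d y - real (Suc N) * d x\<bar> \<le> 1" by linarith
            then have "real (Suc N) * \<bar>d y - d x\<bar> \<le> 1"
              by (metis abs_mult abs_of_nat right_diff_distrib)
            then show ?thesis by (simp add: field_simps)
          qed
          then show "\<bar>indicator ?B y * d y - d x * indicator ?B y\<bar>
              \<le> 1 / real (Suc N) * indicator ?B y + indicator (?B - A N j) y"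
            using dd by (auto split: split_indicator simp: add_increasing)
        qed (use intd in auto)
        also have "\<dots> = ?m n / real (Suc N) + measure \<mu> (?B - A N j)"
          by (subst Bochner_Integration.integral_add) (auto simp: space)
        finally have "\<bar>?I n - d x * ?m n\<bar> \<le> ?m n / real (Suc N) + measure \<mu> (?B - A N j)" .
        then have "\<bar>?I n - d x * ?m n\<bar> / ?m n \<le> (?m n / real (Suc N) + measure \<mu> (?B - A N j)) / ?m n"
          using m by (intro divide_right_mono) auto
        also have "\<dots> = 1 / real (Suc N) + measure \<mu> (?B - A N j) / ?m n"
          using m by (simp add: add_divide_distrib)
        also have "\<dots> < e" using elim N by linarith
        also have "\<bar>?I n - d x * ?m n\<bar> / ?m n = dist (?I n / ?m n) (d x)"
        proof -
          have "?I n / ?m n - d x = (?I n - d x * ?m n) / ?m n" using m by (simp add: field_simps)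
          then show ?thesis using m by (simp add: dist_real_def)
        qed
        finally show ?case .
      qed
    qed
  qed
qed

section \<open>Exact-dimensionality of Bernoulli convolutions\<close>
lemma AE_le_one_of_density_le:
  assumes M: "finite_measure M" and f [measurable]: "f \<in> borel_measurable M"
    and le: "\<And>A. A \<in> sets M \<Longrightarrow> emeasure (density M f) A \<le> emeasure M A"
  shows "AE x in M. f x \<le> 1"
proof -
  interpret finite_measure M by fact
  let ?S = "{x \<in> space M. 1 < f x}"
  have S [measurable]: "?S \<in> sets M" by measurable
  have "(\<integral>\<^sup>+x. f x * indicator ?S x - indicator ?S x \<partial>M) =
      (\<integral>\<^sup>+x. f x * indicator ?S x \<partial>M) - (\<integral>\<^sup>+x. indicator ?S x \<partial>M)"
    by (rule nn_integral_diff) (auto intro!: AE_I2 split: split_indicator)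
  also have "\<dots> = emeasure (density M f) ?S - emeasure M ?S"
    by (simp add: emeasure_density)
  also have "\<dots> = 0" using le[OF S] by (auto simp: diff_eq_0_iff_ennreal emeasure_eq_measure less_top[symmetric] top_unique)
  finally have "AE x in M. f x * indicator ?S x - indicator ?S x = 0"
    by (subst (asm) nn_integral_0_iff_AE) auto
  then show ?thesis
  proof (rule AE_mp, intro AE_I2 impI)
    fix x assume x: "x \<in> space M" "f x * indicator ?S x - indicator ?S x = 0"
    show "f x \<le> 1"
    proof (rule ccontr)
      assume "\<not> f x \<le> 1"
      then have "1 < f x" by simp
      then have "f x - 1 = 0" using x by simp
      then show False using \<open>1 < f x\<close> by (cases "f x") (auto simp: diff_eq_0_iff_ennreal)
    qed
  qed
qed

lemma bounded_density_exists:
  fixes \<mu> \<nu> :: "real measure"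
  assumes \<mu>: "finite_measure \<mu>" "sets \<mu> = sets borel" and \<nu>: "finite_measure \<nu>" "sets \<nu> = sets borel"
    and le: "\<And>A. A \<in> sets borel \<Longrightarrow> measure \<nu> A \<le> measure \<mu> A"
  obtains d :: "real \<Rightarrow> real" where "d \<in> borel_measurable borel" "\<And>x. 0 \<le> d x" "\<And>x. d x \<le> 1"
    "\<And>A. A \<in> sets borel \<Longrightarrow> measure \<nu> A = (\<integral>y. indicator A y * d y \<partial>\<mu>)"
proof -
  interpret \<mu>: finite_measure \<mu> by fact
  interpret \<nu>: finite_measure \<nu> by fact
  have [measurable_cong]: "sets \<mu> = sets borel" by fact
  have em: "emeasure \<nu> A \<le> emeasure \<mu> A" if "A \<in> sets borel" for A
    using le[OF that] by (simp add: \<mu>.emeasure_eq_measure \<nu>.emeasure_eq_measure)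
  have "absolutely_continuous \<mu> \<nu>"
    unfolding absolutely_continuous_def
  proof
    fix A assume "A \<in> null_sets \<mu>"
    then have "A \<in> sets borel" "emeasure \<mu> A = 0" using \<mu>(2) by auto
    then show "A \<in> null_sets \<nu>" using em[of A] \<nu>(2) by (auto simp: null_sets_def)
  qed
  then obtain f where f: "f \<in> borel_measurable \<mu>" "density \<mu> f = \<nu>"
    using \<mu>.Radon_Nikodym[of \<nu>] \<mu>(2) \<nu>(2) by auto
  have [measurable]: "f \<in> borel_measurable borel"
    using f(1) measurable_cong_sets[OF \<mu>(2) refl] by blast
  have ae: "AE x in \<mu>. f x \<le> 1"
    using f em \<mu>(2) by (intro AE_le_one_of_density_le \<mu>(1)) auto
  define d where "d x = min 1 (enn2real (f x))" for x
  have fd: "AE x in \<mu>. f x = ennreal (d x)"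
    using ae
  proof eventually_elim
    case (elim x)
    then have fin: "f x < \<top>" using ennreal_one_less_top by (rule le_less_trans)
    have "enn2real (f x) \<le> 1" using enn2real_mono[OF elim] by simp
    then show ?case using fin by (simp add: d_def)
  qed
  show ?thesis
  proof
    show [measurable]: "d \<in> borel_measurable borel" unfolding d_def by measurable
    show d: "\<And>x. 0 \<le> d x" "\<And>x. d x \<le> 1" by (auto simp: d_def)
    fix A :: "real set" assume [measurable]: "A \<in> sets borel"
    have "emeasure \<nu> A = (\<integral>\<^sup>+y. f y * indicator A y \<partial>\<mu>)"
      using f \<open>A \<in> sets borel\<close> \<mu>(2) by (subst f(2)[symmetric], subst emeasure_density) auto
    also have "\<dots> = (\<integral>\<^sup>+y. ennreal (indicator A y * d y) \<partial>\<mu>)"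
      using fd by (intro nn_integral_cong_AE) (auto elim!: eventually_mono split: split_indicator)
    also have "\<dots> = ennreal (\<integral>y. indicator A y * d y \<partial>\<mu>)"
    proof (rule nn_integral_eq_integral)
      show "integrable \<mu> (\<lambda>y. indicator A y * d y)"
        by (rule \<mu>.integrable_const_bound[of _ 1]) (use d in \<open>auto intro!: AE_I2 simp: indicator_def\<close>)
    qed (use d in \<open>auto intro!: AE_I2\<close>)
    finally show "measure \<nu> A = (\<integral>y. indicator A y * d y \<partial>\<mu>)"
      using d by (simp add: \<nu>.emeasure_eq_measure integral_nonneg)
  qed
qed

text \<open>Radii in geometric progression suffice: between consecutive ones \<open>m\<close> is monotone, while \<open>ln r\<close> changes by
  the constant \<open>ln \<beta>\<close>.\<close>
lemma sequential_local_dimension: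
  fixes m :: "real \<Rightarrow> real"
  assumes mono: "\<And>r s. 0 < r \<Longrightarrow> r \<le> s \<Longrightarrow> m r \<le> m s"
    and pos: "\<And>n::nat. 0 < m (c / \<beta> ^ n)"
    and le1: "\<And>r. m r \<le> 1"
    and c: "0 < c" and \<beta>: "1 < \<beta>"
    and lim: "(\<lambda>n. ln (m (c / \<beta> ^ n)) / n) \<longlonglongrightarrow> - h"
  shows "((\<lambda>r. ln (m r) / ln r) \<longlongrightarrow> h / ln \<beta>) (at_right 0)"
proof -
  define n where "n r = nat \<lfloor>log \<beta> (c / r)\<rfloor>" for r
  define a where "a k = - ln (m (c / \<beta> ^ k))" for k
  have ln\<beta>: "ln \<beta> > 0" using \<beta> by simp
  have a_lim: "(\<lambda>k. a k / k) \<longlonglongrightarrow> h"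
    using tendsto_minus[OF lim] by (simp add: a_def)
  have n_lim: "filterlim n at_top (at_right 0)"
  proof -
    have "filterlim (\<lambda>r. c * inverse r) at_top (at_right 0)"
      by (intro filterlim_tendsto_pos_mult_at_top[OF tendsto_const c] filterlim_inverse_at_top_right)
    then have "filterlim (\<lambda>r. ln (c / r) / ln \<beta>) at_top (at_right 0)"
      unfolding divide_inverse using ln\<beta>
      by (intro filterlim_at_top_mult_tendsto_pos[OF tendsto_const] filterlim_compose[OF ln_at_top]) auto
    then show ?thesis unfolding n_def log_def
      by (intro filterlim_compose[OF filterlim_nat_sequentially] filterlim_compose[OF filterlim_floor_sequentially])
  qed
  have bounds: "\<forall>\<^sub>F r in at_right 0. a (n r) / ((real (n r) + 1) * ln \<beta> - ln c) \<le> ln (m r) / ln r \<and>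
      ln (m r) / ln r \<le> a (Suc (n r)) / (real (n r) * ln \<beta> - ln c)"
  proof -
    obtain k0 :: nat where k0: "\<bar>ln c\<bar> / ln \<beta> < k0" using reals_Archimedean2 by blast
    have "\<forall>\<^sub>F r in at_right 0. n r \<ge> Suc k0"
      using n_lim by (simp add: filterlim_at_top)
    moreover have "\<forall>\<^sub>F r in at_right (0::real). r < 1 \<and> 0 < r"
      unfolding eventually_at_right_field by (intro exI[of _ 1]) auto
    ultimately show ?thesis
    proof eventually_elim
      case (elim r)
      then have r: "0 < r" "r < 1" and nr: "n r \<ge> Suc k0" by auto
      have "\<lfloor>log \<beta> (c / r)\<rfloor> = int (n r)" using nr by (auto simp: n_def nat_eq_iff2)
      then have fl: "n r \<le> log \<beta> (c / r)" "log \<beta> (c / r) < real (n r) + 1" by linarith+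
      have lo: "real (n r) * ln \<beta> - ln c \<le> - ln r" "- ln r \<le> (real (n r) + 1) * ln \<beta> - ln c"
        using fl ln\<beta> c r by (auto simp: log_def ln_div field_simps)
      have rle: "r \<le> c / \<beta> ^ n r"
      proof -
        have "ln r \<le> ln (c / \<beta> ^ n r)" using lo(1) c \<beta> by (simp add: ln_div ln_realpow)
        then show ?thesis using r c \<beta> by (subst (asm) ln_le_cancel_iff) auto
      qed
      have rge: "c / \<beta> ^ Suc (n r) \<le> r"
      proof -
        have "ln (c / \<beta> ^ Suc (n r)) \<le> ln r" using lo(2) c \<beta> by (simp add: ln_div ln_realpow ln_mult algebra_simps)
        then show ?thesis using r c \<beta> by (subst (asm) ln_le_cancel_iff) auto
      qed
      have m1: "m (c / \<beta> ^ Suc (n r)) \<le> m r" using rge c \<beta> by (intro mono) auto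
      have m2: "m r \<le> m (c / \<beta> ^ n r)" using rle r by (intro mono) auto
      have mr: "0 < m r" using m1 pos[of "Suc (n r)"] by linarith
      have am: "a (n r) \<le> - ln (m r)" "- ln (m r) \<le> a (Suc (n r))"
        unfolding a_def using m2 mr pos[of "n r"] ln_le_cancel_iff[OF pos[of "Suc (n r)"] mr] m1 by auto
      have a0: "0 \<le> a k" for k unfolding a_def using le1[of "c / \<beta> ^ k"] pos[of k] by simp
      have "\<bar>ln c\<bar> < real k0 * ln \<beta>" using k0 ln\<beta> by (simp add: pos_divide_less_eq)
      also have "\<dots> \<le> real (n r) * ln \<beta>" using nr ln\<beta> by (intro mult_right_mono) auto
      finally have den: "0 < real (n r) * ln \<beta> - ln c" by linarith
      have lnr: "0 < - ln r" using r by simp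
      have "a (n r) / ((real (n r) + 1) * ln \<beta> - ln c) \<le> - ln (m r) / - ln r"
        using a0[of "n r"] am(1) lnr lo(2) by (intro frac_le) auto
      moreover have "- ln (m r) / - ln r \<le> a (Suc (n r)) / (real (n r) * ln \<beta> - ln c)"
        using a0[of "n r"] am den lo(1) by (intro frac_le) auto
      ultimately show ?case by simp
    qed
  qed
  have shifted: "(\<lambda>k. a k / (real k * ln \<beta> - C)) \<longlonglongrightarrow> h / ln \<beta>" for C
  proof -
    have "(\<lambda>k. (a k / real k) / (ln \<beta> - C * inverse (real k))) \<longlonglongrightarrow> h / (ln \<beta> - C * 0)"
      using ln\<beta> by (intro tendsto_intros a_lim lim_inverse_n) auto
    then have "(\<lambda>k. (a k / real k) / (ln \<beta> - C * inverse (real k))) \<longlonglongrightarrow> h / ln \<beta>" by simp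
    moreover have "\<forall>\<^sub>F k in sequentially. (a k / real k) / (ln \<beta> - C * inverse (real k)) = a k / (real k * ln \<beta> - C)"
      using eventually_gt_at_top[of 0]
    proof eventually_elim
      case (elim k)
      then have "real k * (ln \<beta> - C * inverse (real k)) = real k * ln \<beta> - C" by (simp add: field_simps)
      then show ?case by (metis divide_divide_eq_left)
    qed
    ultimately show ?thesis by (rule Lim_transform_eventually)
  qed
  show ?thesis
  proof (rule tendsto_sandwich)
    show "\<forall>\<^sub>F r in at_right 0. a (n r) / ((real (n r) + 1) * ln \<beta> - ln c) \<le> ln (m r) / ln r"
      using bounds by eventually_elim simp
    show "\<forall>\<^sub>F r in at_right 0. ln (m r) / ln r \<le> a (Suc (n r)) / (real (n r) * ln \<beta> - ln c)"
      using bounds by eventually_elim simp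
    have "(\<lambda>k. a k / ((real k + 1) * ln \<beta> - ln c)) \<longlonglongrightarrow> h / ln \<beta>"
      using shifted[of "ln c - ln \<beta>"] by (simp add: algebra_simps)
    then show "((\<lambda>r. a (n r) / ((real (n r) + 1) * ln \<beta> - ln c)) \<longlongrightarrow> h / ln \<beta>) (at_right 0)"
      by (rule filterlim_compose[OF _ n_lim])
    have "(\<lambda>k. a (Suc k) / (real k * ln \<beta> - ln c)) \<longlonglongrightarrow> h / ln \<beta>"
      using LIMSEQ_Suc[OF shifted[of "ln c + ln \<beta>"]] by (simp add: algebra_simps)
    then show "((\<lambda>r. a (Suc (n r)) / (real (n r) * ln \<beta> - ln c)) \<longlongrightarrow> h / ln \<beta>) (at_right 0)"
      by (rule filterlim_compose[OF _ n_lim])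
  qed
qed

lemma ball_real_eq: "ball (x :: real) r = {x - r<..<x + r}"
  by (auto simp: dist_real_def)

text \<open>The constant \<open>c\<close> exceeds the length of the interval that carries the measure, so a ball of radius \<open>c\<close> around any
  digit sum has full measure; this is where the telescoping sum for \<open>ln (\<mu> (B\<^sub>n))\<close> ends.\<close>
locale bernoulli_balls =
  fixes \<beta> c :: real
  assumes \<beta>: "1 < \<beta>" and c: "1 / (\<beta> - 1) < c"
begin

abbreviation "\<mu> \<equiv> bernoulli_convolution \<beta>"
abbreviation "point \<equiv> digit_sum \<beta>"

text \<open>The law of the digit sum given that the first digit is \<open>b\<close>, see \<open>prob_first_digit\<close>.\<close>
definition branch :: "bool \<Rightarrow> real measure" where
  "branch b = distr \<mu> borel (\<lambda>y. (of_bool b + y) / \<beta>)"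

lemma sets_bernoulli [simp, measurable_cong]: "sets \<mu> = sets borel"
  by (simp add: bernoulli_convolution_def)

lemma space_bernoulli [simp]: "space \<mu> = UNIV"
  by (simp add: bernoulli_convolution_def)

lemma sets_branch [simp, measurable_cong]: "sets (branch b) = sets borel"
  by (simp add: branch_def)

lemma prob_space_branch: "prob_space (branch b)"
  unfolding branch_def by (rule prob_space.prob_space_distr[OF prob_space_bernoulli_convolution]) measurable

lemma measure_bernoulli: "X \<in> sets borel \<Longrightarrow> measure \<mu> X = coin.prob {\<omega>. point \<omega> \<in> X}"
  unfolding bernoulli_convolution_def by (subst measure_distr) (auto simp: vimage_def)

lemma measure_branch: "X \<in> sets borel \<Longrightarrow> measure (branch b) X = measure \<mu> {y. (of_bool b + y) / \<beta> \<in> X}"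
  unfolding branch_def by (subst measure_distr) (auto simp: vimage_def)

lemma sets_first_digit:
  assumes X: "\<And>b. X b \<in> sets borel"
  shows "{\<omega>. point \<omega> \<in> X (\<omega> 0)} \<in> sets coin_space"
proof -
  note [measurable] = X
  have "{\<omega> \<in> space coin_space. (\<omega> 0 \<longrightarrow> point \<omega> \<in> X True) \<and> (\<not> \<omega> 0 \<longrightarrow> point \<omega> \<in> X False)} \<in> sets coin_space"
    by measurable
  also have "{\<omega> \<in> space coin_space. (\<omega> 0 \<longrightarrow> point \<omega> \<in> X True) \<and> (\<not> \<omega> 0 \<longrightarrow> point \<omega> \<in> X False)} =
      {\<omega>. point \<omega> \<in> X (\<omega> 0)}"
  proof (intro set_eqI)
    fix \<omega>
    show "\<omega> \<in> {\<omega> \<in> space coin_space. (\<omega> 0 \<longrightarrow> point \<omega> \<in> X True) \<and> (\<not> \<omega> 0 \<longrightarrow> point \<omega> \<in> X False)} \<longleftrightarrow>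
        \<omega> \<in> {\<omega>. point \<omega> \<in> X (\<omega> 0)}" by (cases "\<omega> 0") auto
  qed
  finally show ?thesis .
qed

lemma prob_first_digit:
  assumes X: "\<And>b. X b \<in> sets borel"
  shows "coin.prob {\<omega>. point \<omega> \<in> X (\<omega> 0)} = (measure (branch True) (X True) + measure (branch False) (X False)) / 2"
proof -
  note [measurable] = X sets_first_digit[OF X]
  have b: "(\<integral>\<^sup>+\<omega>. indicator {\<omega>. point \<omega> \<in> X (\<omega> 0)} (case_nat b \<omega>) \<partial>coin_space) = ennreal (measure (branch b) (X b))" for b
  proof -
    have "{y \<in> space borel. (of_bool b + y) / \<beta> \<in> X b} \<in> sets borel" by measurable
    then have *: "{y. (of_bool b + y) / \<beta> \<in> X b} \<in> sets borel" by simp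
    have "{\<omega> \<in> space coin_space. point \<omega> \<in> {y. (of_bool b + y) / \<beta> \<in> X b}} \<in> sets coin_space"
      using * by measurable
    then have [measurable]: "{\<omega>. point \<omega> \<in> {y. (of_bool b + y) / \<beta> \<in> X b}} \<in> sets coin_space" by simp
    have "(\<integral>\<^sup>+\<omega>. indicator {\<omega>. point \<omega> \<in> X (\<omega> 0)} (case_nat b \<omega>) \<partial>coin_space) =
        (\<integral>\<^sup>+\<omega>. indicator {\<omega>. point \<omega> \<in> {y. (of_bool b + y) / \<beta> \<in> X b}} \<omega> \<partial>coin_space)"
      by (intro nn_integral_cong) (auto simp: digit_sum_case_nat[OF \<beta>] split: split_indicator)
    also have "\<dots> = ennreal (coin.prob {\<omega>. point \<omega> \<in> {y. (of_bool b + y) / \<beta> \<in> X b}})"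
      unfolding coin.emeasure_eq_measure[symmetric] by (rule nn_integral_indicator) measurable
    also have "\<dots> = ennreal (measure (branch b) (X b))"
      unfolding measure_branch[OF X] measure_bernoulli[OF *] ..
    finally show ?thesis .
  qed
  have "ennreal (coin.prob {\<omega>. point \<omega> \<in> X (\<omega> 0)}) = (\<integral>\<^sup>+\<omega>. indicator {\<omega>. point \<omega> \<in> X (\<omega> 0)} \<omega> \<partial>coin_space)"
    by (simp add: coin.emeasure_eq_measure)
  also have "\<dots> = (1/2) * ennreal (measure (branch True) (X True)) + (1/2) * ennreal (measure (branch False) (X False))"
    by (subst nn_integral_coin_space_first) (simp_all add: b)
  also have "\<dots> = ennreal ((measure (branch True) (X True) + measure (branch False) (X False)) / 2)"
  proof -
    have h: "(1/2 :: ennreal) = ennreal (1/2)" by (simp add: ennreal_divide_numeral flip: ennreal_1)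
    have e: "(1/2) * ennreal a = ennreal (a / 2)" if "0 \<le> a" for a
      unfolding h using that by (subst ennreal_mult[symmetric]) auto
    show ?thesis
      by (simp only: e[OF measure_nonneg] add_divide_distrib) (simp add: ennreal_plus[symmetric] del: ennreal_plus)
  qed
  finally show ?thesis by (simp add: measure_nonneg)
qed

lemma measure_bernoulli_branches:
  assumes "X \<in> sets borel"
  shows "measure \<mu> X = (measure (branch True) X + measure (branch False) X) / 2"
  using prob_first_digit[of "\<lambda>_. X"] assms by (simp add: measure_bernoulli)

lemma measure_branch_le:
  assumes "X \<in> sets borel"
  shows "measure (branch b) X \<le> 2 * measure \<mu> X"
proof -
  have "2 * measure \<mu> X = measure (branch True) X + measure (branch False) X"
    using measure_bernoulli_branches[OF assms] by simp
  moreover have "0 \<le> measure (branch True) X" "0 \<le> measure (branch False) X" by (rule measure_nonneg)+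
  ultimately have "measure (branch True) X \<le> 2 * measure \<mu> X \<and> measure (branch False) X \<le> 2 * measure \<mu> X"
    by linarith
  then show ?thesis by (cases b) auto
qed

text \<open>Self-similarity: the map \<open>y \<mapsto> (\<omega> 0 + y) / \<beta>\<close> sends the digit sum of \<open>shift \<omega>\<close> to that of \<open>\<omega>\<close> and divides
  distances by \<open>\<beta>\<close>.\<close>
lemma measure_branch_ball:
  "measure (branch (\<omega> 0)) (ball (point \<omega>) (r / \<beta>)) = measure \<mu> (ball (point (shift \<omega>)) r)"
proof -
  have "{y. (of_bool (\<omega> 0) + y) / \<beta> \<in> ball (point \<omega>) (r / \<beta>)} = ball (point (shift \<omega>)) r"
    unfolding digit_sum_unfold[OF \<beta>, of \<omega>] using \<beta>
    by (auto simp: dist_real_def diff_divide_distrib[symmetric] divide_less_cancel abs_divide)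
  then show ?thesis by (simp add: measure_branch)
qed

lemma measure_ball_full: "measure \<mu> (ball (point \<omega>) c) = 1"
proof -
  have "dist (point \<omega>) (point \<eta>) < c" for \<eta>
    using digit_sum_bounds[OF \<beta>, of \<omega>] digit_sum_bounds[OF \<beta>, of \<eta>] c
    by (auto simp: dist_real_def abs_less_iff)
  then have "{\<eta>. point \<eta> \<in> ball (point \<omega>) c} = UNIV" by simp
  then show ?thesis using coin.prob_space by (simp add: measure_bernoulli)
qed

lemma measure_ball_pos: "measure \<mu> (ball (point \<omega>) (c / \<beta> ^ n)) > 0"
proof (induction n arbitrary: \<omega>)
  case 0
  show ?case by (simp add: measure_ball_full)
next
  case (Suc n)
  have "0 < measure (branch (\<omega> 0)) (ball (point \<omega>) (c / \<beta> ^ n / \<beta>))"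
    unfolding measure_branch_ball by (rule Suc)
  also have "\<dots> \<le> 2 * measure \<mu> (ball (point \<omega>) (c / \<beta> ^ n / \<beta>))" by (rule measure_branch_le) simp
  finally show ?case by (simp add: mult.commute)
qed

text \<open>The logarithm of the prior probability 1/2 of the first digit, divided by its posterior probability once the point
  is known up to precision \<open>c / \<beta> ^ n\<close>.\<close>
definition log_ratio :: "nat \<Rightarrow> (nat \<Rightarrow> bool) \<Rightarrow> real" where
  "log_ratio n \<omega> = ln (measure \<mu> (ball (point \<omega>) (c / \<beta> ^ n)) / measure (branch (\<omega> 0)) (ball (point \<omega>) (c / \<beta> ^ n)))"

lemma c_pos: "0 < c"
  using c \<beta> by (meson diff_gt_0_iff_gt less_trans zero_less_divide_1_iff)

lemma ln_measure_ball_eq_sum: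
  "ln (measure \<mu> (ball (point \<omega>) (c / \<beta> ^ n))) = (\<Sum>k<n. log_ratio (n - k) ((shift ^^ k) \<omega>))"
proof (induction n arbitrary: \<omega>)
  case 0
  show ?case by (simp add: measure_ball_full)
next
  case (Suc n)
  have e: "measure (branch (\<omega> 0)) (ball (point \<omega>) (c / \<beta> ^ Suc n)) = measure \<mu> (ball (point (shift \<omega>)) (c / \<beta> ^ n))"
    using measure_branch_ball[of \<omega> "c / \<beta> ^ n"] by (simp add: mult.commute)
  have "ln (measure \<mu> (ball (point \<omega>) (c / \<beta> ^ Suc n))) =
      log_ratio (Suc n) \<omega> + ln (measure \<mu> (ball (point (shift \<omega>)) (c / \<beta> ^ n)))"
    unfolding log_ratio_def e
    using measure_ball_pos[of \<omega> "Suc n"] measure_ball_pos[of "shift \<omega>" n]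
    by (subst ln_div) auto
  then show ?case
    by (subst sum.lessThan_Suc_shift) (simp add: Suc.IH funpow_swap1)
qed

lemma measurable_log_ratio [measurable]: "log_ratio n \<in> borel_measurable coin_space"
proof -
  have fm: "finite_measure \<mu>" "finite_measure (branch b)" for b
    using prob_space_bernoulli_convolution prob_space_branch by (auto simp: prob_space_def)
  have [measurable]: "(\<lambda>y. measure \<mu> (ball y r)) \<in> borel_measurable borel"
    "(\<lambda>y. measure (branch b) (ball y r)) \<in> borel_measurable borel" for r b
    using measurable_measure_ball[OF fm(1) sets_bernoulli, of UNIV]
      measurable_measure_ball[OF fm(2) sets_branch, of UNIV] by simp_all
  have "log_ratio n = (\<lambda>\<omega>. ln (measure \<mu> (ball (point \<omega>) (c / \<beta> ^ n)) /
      (if \<omega> 0 then measure (branch True) (ball (point \<omega>) (c / \<beta> ^ n)) else measure (branch False) (ball (point \<omega>) (c / \<beta> ^ n)))))"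
  proof
    fix \<omega>
    show "log_ratio n \<omega> = ln (measure \<mu> (ball (point \<omega>) (c / \<beta> ^ n)) /
      (if \<omega> 0 then measure (branch True) (ball (point \<omega>) (c / \<beta> ^ n)) else measure (branch False) (ball (point \<omega>) (c / \<beta> ^ n))))"
      by (cases "\<omega> 0") (simp_all add: log_ratio_def)
  qed
  then show ?thesis by simp
qed

lemma log_ratio_lower: "log_ratio (Suc n) \<omega> \<ge> - ln 2"
proof -
  let ?B = "ball (point \<omega>) (c / \<beta> ^ Suc n)"
  have b: "measure (branch (\<omega> 0)) ?B > 0"
    using measure_branch_ball[of \<omega> "c / \<beta> ^ n"] measure_ball_pos[of "shift \<omega>" n]
    by (simp add: mult.commute)
  have "measure (branch (\<omega> 0)) ?B \<le> 2 * measure \<mu> ?B" by (rule measure_branch_le) simp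
  then have half: "1 / 2 \<le> measure \<mu> ?B / measure (branch (\<omega> 0)) ?B" using b by (simp add: field_simps)
  then have "0 < measure \<mu> ?B / measure (branch (\<omega> 0)) ?B" by linarith
  with half have "ln (1 / 2) \<le> log_ratio (Suc n) \<omega>"
    unfolding log_ratio_def by (subst ln_le_cancel_iff) auto
  then show ?thesis by (simp add: ln_div)
qed

text \<open>A large ratio at \<open>\<omega>\<close> puts the point into the set where \<open>\<mu>\<close> exceeds \<open>exp u\<close> times \<open>branch (\<omega> 0)\<close> on some
  ball. The maximal inequality bounds the mass that \<open>branch (\<omega> 0)\<close>, the law of the point given its first digit,
  gives to that set.\<close>
lemma log_ratio_tail:
  "coin.prob {\<omega>. \<exists>n. log_ratio (Suc n) \<omega> > u} \<le> 2 * exp (- u)"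
proof -
  define E where "E b = {y. \<exists>n. exp u * measure (branch b) (ball y (c / \<beta> ^ Suc n)) \<le> measure \<mu> (ball y (c / \<beta> ^ Suc n))}" for b
  have fm: "finite_measure \<mu>" "finite_measure (branch b)" for b
    using prob_space_bernoulli_convolution prob_space_branch by (auto simp: prob_space_def)
  have [measurable]: "(\<lambda>y. measure \<mu> (ball y r)) \<in> borel_measurable borel"
    "(\<lambda>y. measure (branch b) (ball y r)) \<in> borel_measurable borel" for r b
    using measurable_measure_ball[OF fm(1) sets_bernoulli, of UNIV]
      measurable_measure_ball[OF fm(2) sets_branch, of UNIV] by simp_all
  have E: "E b \<in> sets borel" for b
  proof -
    have "{y \<in> space borel. \<exists>n. exp u * measure (branch b) (ball y (c / \<beta> ^ Suc n)) \<le> measure \<mu> (ball y (c / \<beta> ^ Suc n))} \<in> sets borel"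
      by measurable
    then show ?thesis by (simp add: E_def)
  qed
  have bE: "exp u * measure (branch b) (E b) \<le> 2" for b
  proof -
    have "exp u * measure (branch b) (E b) \<le> 2 * measure \<mu> UNIV"
    proof (rule maximal_inequality[OF fm(2) _ fm(1) _ E])
      fix y assume "y \<in> E b"
      then obtain n where "exp u * measure (branch b) (ball y (c / \<beta> ^ Suc n)) \<le> measure \<mu> (ball y (c / \<beta> ^ Suc n))"
        unfolding E_def by blast
      moreover have "0 < c / \<beta> ^ Suc n" using \<beta> c_pos by simp
      ultimately show "\<exists>r>0. exp u * measure (branch b) (ball y r) \<le> measure \<mu> (ball y r)" by blast
    qed simp_all
    then show ?thesis using prob_space.prob_space[OF prob_space_bernoulli_convolution, of \<beta>] by simp
  qed
  have "{\<omega>. \<exists>n. log_ratio (Suc n) \<omega> > u} \<subseteq> {\<omega>. point \<omega> \<in> E (\<omega> 0)}"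
  proof
    fix \<omega> assume "\<omega> \<in> {\<omega>. \<exists>n. log_ratio (Suc n) \<omega> > u}"
    then obtain n where n: "u < log_ratio (Suc n) \<omega>" by blast
    let ?B = "ball (point \<omega>) (c / \<beta> ^ Suc n)"
    have b: "measure (branch (\<omega> 0)) ?B > 0"
      using measure_branch_ball[of \<omega> "c / \<beta> ^ n"] measure_ball_pos[of "shift \<omega>" n]
      by (simp add: mult.commute)
    have "exp u \<le> exp (log_ratio (Suc n) \<omega>)" using n by simp
    also have "\<dots> = measure \<mu> ?B / measure (branch (\<omega> 0)) ?B"
      unfolding log_ratio_def using b measure_ball_pos[of \<omega> "Suc n"] by (subst exp_ln) auto
    finally have "exp u * measure (branch (\<omega> 0)) ?B \<le> measure \<mu> ?B" using b by (simp add: pos_le_divide_eq)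
    then show "\<omega> \<in> {\<omega>. point \<omega> \<in> E (\<omega> 0)}" unfolding E_def by blast
  qed
  moreover have "{\<omega>. point \<omega> \<in> E (\<omega> 0)} \<in> sets coin_space" by (rule sets_first_digit[OF E])
  ultimately have "coin.prob {\<omega>. \<exists>n. log_ratio (Suc n) \<omega> > u} \<le> coin.prob {\<omega>. point \<omega> \<in> E (\<omega> 0)}"
    by (rule coin.finite_measure_mono)
  also have "\<dots> = (measure (branch True) (E True) + measure (branch False) (E False)) / 2"
    by (rule prob_first_digit[OF E])
  also have "\<dots> \<le> 2 * exp (- u)"
    using bE[of True] bE[of False] by (simp add: exp_minus field_simps)
  finally show ?thesis .
qed

lemma log_ratio_dominated:
  obtains G where "integrable coin_space G" "AE \<omega> in coin_space. \<forall>n. \<bar>log_ratio (Suc n) \<omega>\<bar> \<le> G \<omega>"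
proof -
  define A where "A k = {\<omega>. \<exists>n. log_ratio (Suc n) \<omega> > real k}" for k :: nat
  have A [measurable]: "A k \<in> sets coin_space" for k
  proof -
    have "{\<omega> \<in> space coin_space. \<exists>n. log_ratio (Suc n) \<omega> > real k} \<in> sets coin_space" by measurable
    then show ?thesis by (simp add: A_def)
  qed
  \<comment> \<open>\<open>N\<close> counts the natural numbers below the supremum of the ratios, hence dominates them all.\<close>
  define N where "N \<omega> = (\<Sum>k. indicator (A k) \<omega> :: ennreal)" for \<omega>
  have [measurable]: "N \<in> borel_measurable coin_space" unfolding N_def by measurable
  have "(\<integral>\<^sup>+\<omega>. N \<omega> \<partial>coin_space) = (\<Sum>k. emeasure coin_space (A k))"
    unfolding N_def by (subst nn_integral_suminf) auto
  also have "\<dots> \<le> (\<Sum>k. ennreal (2 * exp (- 1) ^ k))"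
  proof (rule suminf_le)
    fix k
    have "coin.prob (A k) \<le> 2 * exp (- real k)" unfolding A_def by (rule log_ratio_tail)
    also have "exp (- real k) = exp (- 1) ^ k" by (simp add: exp_of_nat_mult[symmetric])
    finally show "emeasure coin_space (A k) \<le> ennreal (2 * exp (- 1) ^ k)"
      by (simp add: coin.emeasure_eq_measure)
  qed auto
  also have "\<dots> = ennreal (\<Sum>k. 2 * exp (- 1) ^ k)"
    by (intro suminf_ennreal2 summable_mult summable_geometric) auto
  also have "\<dots> < \<top>" by simp
  finally have N_fin: "(\<integral>\<^sup>+\<omega>. N \<omega> \<partial>coin_space) < \<top>" .
  then have AE_fin: "AE \<omega> in coin_space. N \<omega> \<noteq> \<top>"
    using nn_integral_PInf_AE[of N coin_space] by auto
  have "(\<integral>\<^sup>+\<omega>. ennreal (norm (enn2real (N \<omega>))) \<partial>coin_space) = (\<integral>\<^sup>+\<omega>. N \<omega> \<partial>coin_space)"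
    using AE_fin by (intro nn_integral_cong_AE) (auto elim!: eventually_mono simp: less_top)
  then have int: "integrable coin_space (\<lambda>\<omega>. enn2real (N \<omega>))"
    using N_fin by (intro integrableI_bounded) auto
  have "AE \<omega> in coin_space. \<forall>n. \<bar>log_ratio (Suc n) \<omega>\<bar> \<le> enn2real (N \<omega>) + 1"
    using AE_fin
  proof eventually_elim
    case (elim \<omega>)
    show ?case
    proof
      fix n
      let ?v = "log_ratio (Suc n) \<omega>"
      have "?v \<le> enn2real (N \<omega>)"
      proof -
        have "of_nat (nat \<lceil>?v\<rceil>) = (\<Sum>k<nat \<lceil>?v\<rceil>. indicator (A k) \<omega> :: ennreal)"
        proof -
          have "\<omega> \<in> A k" if "k < nat \<lceil>?v\<rceil>" for k
          proof -
            have "real k < ?v" using that by linarith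
            then show ?thesis unfolding A_def by blast
          qed
          then have "(\<Sum>k<nat \<lceil>?v\<rceil>. indicator (A k) \<omega> :: ennreal) = (\<Sum>k<nat \<lceil>?v\<rceil>. 1)"
            by (intro sum.cong) auto
          then show ?thesis by simp
        qed
        also have "\<dots> \<le> N \<omega>" unfolding N_def by (rule sum_le_suminf) auto
        finally have "enn2real (of_nat (nat \<lceil>?v\<rceil>)) \<le> enn2real (N \<omega>)"
          using elim by (intro enn2real_mono) (auto simp: less_top)
        then have "real (nat \<lceil>?v\<rceil>) \<le> enn2real (N \<omega>)"
          by (simp add: ennreal_of_nat_eq_real_of_nat)
        then show ?thesis by linarith
      qed
      moreover have "- 1 \<le> ?v" using log_ratio_lower[of n \<omega>] ln_2_less_1 by linarith
      ultimately show "\<bar>?v\<bar> \<le> enn2real (N \<omega>) + 1"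
        using enn2real_nonneg[of "N \<omega>"] by linarith
    qed
  qed
  moreover have "integrable coin_space (\<lambda>\<omega>. enn2real (N \<omega>) + 1)" using int by simp
  ultimately show ?thesis using that by blast
qed

text \<open>By differentiation \<open>branch b\<close> over \<open>\<mu>\<close> tends on shrinking balls to a density. At almost every \<open>\<omega>\<close> its limit for the
  branch of the first digit is positive, since the ratios are bounded, so that the logarithms converge as well.\<close>
lemma log_ratio_converges:
  obtains f where "f \<in> borel_measurable coin_space" "AE \<omega> in coin_space. (\<lambda>n. log_ratio n \<omega>) \<longlonglongrightarrow> f \<omega>"
proof -
  have fm: "finite_measure \<mu>" "finite_measure (branch b)" for b
    using prob_space_bernoulli_convolution prob_space_branch by (auto simp: prob_space_def)
  have "\<exists>d :: real \<Rightarrow> real. d \<in> borel_measurable borel \<and> (\<forall>y. 0 \<le> d y \<and> d y \<le> 1) \<and>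
      (\<forall>A\<in>sets borel. measure (branch b) A / 2 = (\<integral>y. indicator A y * d y \<partial>\<mu>))" for b
  proof -
    \<comment> \<open>Half of \<open>branch b\<close> is dominated by \<open>\<mu>\<close>, so its density takes values in \<open>[0, 1]\<close>.\<close>
    let ?\<nu> = "scale_measure (ennreal (1/2)) (branch b)"
    have half: "measure ?\<nu> A = measure (branch b) A / 2" for A
      unfolding measure_def emeasure_scale_measure enn2real_mult by (subst enn2real_ennreal) auto
    have le: "measure ?\<nu> A \<le> measure \<mu> A" if "A \<in> sets borel" for A
      unfolding half using measure_branch_le[OF that, of b] by linarith
    have fin: "finite_measure ?\<nu>"
      using finite_measure.emeasure_finite[OF fm(2), of b]
      by (intro finite_measureI) (simp add: ennreal_mult_eq_top_iff)
    obtain d where "d \<in> borel_measurable borel" "\<And>x. 0 \<le> d x" "\<And>x. d x \<le> 1"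
      "\<And>A. A \<in> sets borel \<Longrightarrow> measure ?\<nu> A = (\<integral>y. indicator A y * d y \<partial>\<mu>)"
      by (rule bounded_density_exists[OF fm(1) sets_bernoulli fin _ le]) simp_all
    then show ?thesis unfolding half by blast
  qed
  then obtain d :: "bool \<Rightarrow> real \<Rightarrow> real" where d [measurable]: "\<And>b. d b \<in> borel_measurable borel"
    and d01: "\<And>b y. 0 \<le> d b y" "\<And>b y. d b y \<le> 1"
    and d_int: "\<And>b A. A \<in> sets borel \<Longrightarrow> measure (branch b) A / 2 = (\<integral>y. indicator A y * d b y \<partial>\<mu>)"
    by metis
  define f where "f \<omega> = - ln (2 * (if \<omega> 0 then d True (point \<omega>) else d False (point \<omega>)))" for \<omega>
  have f_meas: "f \<in> borel_measurable coin_space" unfolding f_def by measurable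
  have f_eq: "f \<omega> = - ln (2 * d (\<omega> 0) (point \<omega>))" for \<omega> by (cases "\<omega> 0") (simp_all add: f_def)
  let ?r = "\<lambda>n. c / \<beta> ^ n"
  have r: "0 < ?r n" "?r \<longlonglongrightarrow> 0" for n
    using \<beta> c_pos by (auto intro: LIMSEQ_divide_realpow_zero)
  have "AE y in \<mu>. \<forall>b. (\<lambda>n. (measure (branch b) (ball y (?r n)) / 2) / measure \<mu> (ball y (?r n))) \<longlonglongrightarrow> d b y"
    unfolding AE_all_countable
    using lebesgue_differentiation[OF fm(1) sets_bernoulli d d01 r(1) r(2)] by (simp add: d_int)
  then have lim: "AE \<omega> in coin_space. \<forall>b. (\<lambda>n. (measure (branch b) (ball (point \<omega>) (?r n)) / 2) / measure \<mu> (ball (point \<omega>) (?r n))) \<longlonglongrightarrow> d b (point \<omega>)"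
    unfolding bernoulli_convolution_def by (rule AE_distrD[rotated]) measurable
  obtain G where G: "AE \<omega> in coin_space. \<forall>n. \<bar>log_ratio (Suc n) \<omega>\<bar> \<le> G \<omega>" by (rule log_ratio_dominated)
  from lim G have "AE \<omega> in coin_space. (\<lambda>n. log_ratio n \<omega>) \<longlonglongrightarrow> f \<omega>"
  proof eventually_elim
    case (elim \<omega>)
    define R where "R n = measure (branch (\<omega> 0)) (ball (point \<omega>) (?r n)) / measure \<mu> (ball (point \<omega>) (?r n))" for n
    have R_lim: "R \<longlonglongrightarrow> 2 * d (\<omega> 0) (point \<omega>)"
      using tendsto_mult_left[OF elim(1)[rule_format, of "\<omega> 0"], of 2] by (simp add: R_def[abs_def])
    have R_ln: "log_ratio n \<omega> = - ln (R n)" for n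
      unfolding log_ratio_def R_def by (metis inverse_divide ln_inverse)
    have R_pos: "0 < R (Suc n)" for n
      unfolding R_def using measure_branch_ball[of \<omega> "?r n"] measure_ball_pos[of "shift \<omega>" n]
        measure_ball_pos[of \<omega> "Suc n"] by (simp add: mult.commute)
    have "exp (- G \<omega>) \<le> R (Suc n)" for n
    proof -
      have "- G \<omega> \<le> ln (R (Suc n))" using elim(2)[rule_format, of n] by (simp add: R_ln abs_le_iff)
      then show ?thesis using R_pos[of n] by (simp add: ln_ge_iff)
    qed
    then have "exp (- G \<omega>) \<le> 2 * d (\<omega> 0) (point \<omega>)"
      by (intro LIMSEQ_le_const[OF LIMSEQ_Suc[OF R_lim]]) auto
    then have "2 * d (\<omega> 0) (point \<omega>) > 0" using exp_gt_zero less_le_trans by blast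
    then show ?case unfolding R_ln f_eq using R_lim by (intro tendsto_intros) auto
  qed
  with f_meas show ?thesis using that by blast
qed

text \<open>Maker's theorem for the telescoped sum. In that sum the depth \<open>n - k\<close> is at least 1, and \<open>max 1\<close> extends the
  family to depth 0 without losing the domination, which is available from depth 1 on.\<close>
lemma ln_measure_ball_limit:
  "\<exists>h. AE \<omega> in coin_space. (\<lambda>n. ln (measure \<mu> (ball (point \<omega>) (c / \<beta> ^ n))) / n) \<longlonglongrightarrow> - h"
proof -
  obtain G where G: "integrable coin_space G" "AE \<omega> in coin_space. \<forall>n. \<bar>log_ratio (Suc n) \<omega>\<bar> \<le> G \<omega>"
    by (rule log_ratio_dominated)
  obtain f where f: "f \<in> borel_measurable coin_space" "AE \<omega> in coin_space. (\<lambda>n. log_ratio n \<omega>) \<longlonglongrightarrow> f \<omega>"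
    by (rule log_ratio_converges)
  have fG: "AE \<omega> in coin_space. \<bar>f \<omega>\<bar> \<le> G \<omega>"
    using G(2) f(2)
  proof eventually_elim
    case (elim \<omega>)
    show ?case
      using elim(1) by (intro LIMSEQ_le_const2[OF tendsto_rabs[OF LIMSEQ_Suc[OF elim(2)]]]) auto
  qed
  have f_int: "integrable coin_space f"
    by (rule Bochner_Integration.integrable_bound[OF G(1) f(1)]) (use fG in \<open>auto elim: eventually_mono\<close>)
  have "AE \<omega> in coin_space. (\<lambda>n. (\<Sum>k<n. log_ratio (max 1 (n - k)) ((shift ^^ k) \<omega>)) / n) \<longlonglongrightarrow> integral\<^sup>L coin_space f"
  proof (rule coin.maker_ergodic_theorem[OF _ f_int, where G = "\<lambda>\<omega>. 2 * G \<omega>"])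
    show "AE \<omega> in coin_space. (\<lambda>n. log_ratio (max 1 n) \<omega>) \<longlonglongrightarrow> f \<omega>"
      using f(2)
    proof eventually_elim
      case (elim \<omega>)
      have "\<forall>\<^sub>F n in sequentially. log_ratio n \<omega> = log_ratio (max 1 n) \<omega>"
        using eventually_ge_at_top[of 1] by eventually_elim (simp add: max_def)
      with elim show ?case by (rule Lim_transform_eventually)
    qed
    show "AE \<omega> in coin_space. \<forall>n. \<bar>log_ratio (max 1 n) \<omega> - f \<omega>\<bar> \<le> 2 * G \<omega>"
      using G(2) fG
    proof eventually_elim
      case (elim \<omega>)
      show ?case
      proof
        fix n
        obtain m where "max 1 n = Suc m" by (cases n) auto
        then show "\<bar>log_ratio (max 1 n) \<omega> - f \<omega>\<bar> \<le> 2 * G \<omega>"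
          using elim(1)[rule_format, of m] elim(2) by simp
      qed
    qed
  qed (use G in auto)
  moreover have "(\<Sum>k<n. log_ratio (max 1 (n - k)) ((shift ^^ k) \<omega>)) = ln (measure \<mu> (ball (point \<omega>) (c / \<beta> ^ n)))" for n \<omega>
    unfolding ln_measure_ball_eq_sum by (intro sum.cong) (auto simp: max_def)
  ultimately show ?thesis by (intro exI[of _ "- integral\<^sup>L coin_space f"]) simp
qed

lemma exact_dimensional: "\<exists>\<alpha>. has_exact_dim \<mu> \<alpha>"
proof -
  note c0 = c_pos
  interpret \<mu>: prob_space \<mu> by (rule prob_space_bernoulli_convolution)
  have fm: "finite_measure \<mu>" by unfold_locales
  have [measurable]: "(\<lambda>y. measure \<mu> (ball y r)) \<in> borel_measurable borel" for r
    using measurable_measure_ball[OF fm sets_bernoulli, of UNIV] by simp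
  let ?m = "\<lambda>n y. ln (measure \<mu> (ball y (c / \<beta> ^ n))) / real n"
  obtain h where h: "AE \<omega> in coin_space. (\<lambda>n. ?m n (point \<omega>)) \<longlonglongrightarrow> - h"
    using ln_measure_ball_limit by blast
  \<comment> \<open>Convergence in a form with countable quantifiers, which is visibly measurable.\<close>
  let ?P = "\<lambda>y. \<forall>j. \<forall>\<^sub>F n in sequentially. \<bar>?m n y - (- h)\<bar> < inverse (Suc j)"
  have iff: "(\<lambda>n. ?m n y) \<longlonglongrightarrow> - h \<longleftrightarrow> ?P y" for y
  proof
    assume "(\<lambda>n. ?m n y) \<longlonglongrightarrow> - h"
    then show "?P y" by (auto simp: tendsto_iff dist_real_def)
  next
    assume P: "?P y"
    show "(\<lambda>n. ?m n y) \<longlonglongrightarrow> - h"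
    proof (rule tendstoI)
      fix e :: real assume "e > 0"
      then obtain j where "inverse (real (Suc j)) < e" using reals_Archimedean by blast
      then show "\<forall>\<^sub>F n in sequentially. dist (?m n y) (- h) < e"
        using P[rule_format, of j] by (auto elim!: eventually_mono simp: dist_real_def)
    qed
  qed
  have meas: "{y \<in> space borel. ?P y} \<in> sets borel" by measurable
  have "AE y in \<mu>. ?P y"
  proof -
    have "(AE y in \<mu>. Q y) \<longleftrightarrow> (AE \<omega> in coin_space. Q (point \<omega>))" if "{y \<in> space borel. Q y} \<in> sets borel" for Q
      unfolding bernoulli_convolution_def by (rule AE_distr_iff[OF measurable_digit_sum that])
    from this[OF meas] show ?thesis using h unfolding iff by blast
  qed
  moreover have "AE y in \<mu>. \<forall>n. measure \<mu> (ball y (c / \<beta> ^ n)) > 0"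
    using c0 \<beta> by (intro AE_measure_ball_pos[OF fm sets_bernoulli]) auto
  ultimately have "AE y in \<mu>. ((\<lambda>r. ln (measure \<mu> (ball y r)) / ln r) \<longlongrightarrow> h / ln \<beta>) (at_right 0)"
  proof eventually_elim
    case (elim y)
    show ?case
    proof (rule sequential_local_dimension[OF _ _ _ c0 \<beta>])
      show "(\<lambda>n. ?m n y) \<longlonglongrightarrow> - h" using elim(1) iff by blast
      show "measure \<mu> (ball y r) \<le> measure \<mu> (ball y s)" if "r \<le> s" for r s
        using that by (intro \<mu>.finite_measure_mono subset_ball) auto
    qed (use elim(2) in auto)
  qed
  then show ?thesis unfolding has_exact_dim_def by (intro exI[of _ "h / ln \<beta>"]) (simp add: ball_real_eq)
qed

end

theorem bernoulli_convolution_exact_dimensional: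
  assumes "1 < \<beta>"
  shows "\<exists>\<alpha>. has_exact_dim (bernoulli_convolution \<beta>) \<alpha>"
proof -
  interpret bernoulli_balls \<beta> "1 / (\<beta> - 1) + 1"
    using assms by unfold_locales auto
  show ?thesis by (rule exact_dimensional)
qed

section \<open>Pairs of nearby points\<close>
text \<open>If \<open>\<alpha> < t < s\<close>, then \<open>\<mu> (ball y r) * r powr -t\<close> is eventually at least 1 for almost every \<open>y\<close>, while its mean is
  at most \<open>K * r powr (s - t)\<close>, which tends to 0; this contradicts Fatou's lemma. Positivity of the measure of balls excludes
  the value \<open>ln 0 = 0\<close>.\<close>
lemma exact_dim_lower_bound_by_correlation:
  fixes \<mu> :: "real measure"
  assumes \<mu>: "prob_space \<mu>" "sets \<mu> = sets borel" and dim: "has_exact_dim \<mu> \<alpha>"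
    and corr: "\<And>r. 0 < r \<Longrightarrow> (\<integral>\<^sup>+y. ennreal (measure \<mu> (ball y r)) \<partial>\<mu>) \<le> ennreal (K * r powr s)"
  shows "s \<le> \<alpha>"
proof (rule ccontr)
  assume "\<not> s \<le> \<alpha>"
  then obtain t where t: "\<alpha> < t" "t < s" using dense[of \<alpha> s] by (auto simp: not_le)
  interpret \<mu>: prob_space \<mu> by fact
  have fm: "finite_measure \<mu>" by unfold_locales
  have [measurable_cong]: "sets \<mu> = sets borel" by fact
  have [measurable]: "(\<lambda>y. measure \<mu> (ball y r)) \<in> borel_measurable borel" for r
    using measurable_measure_ball[OF fm \<mu>(2), of UNIV] by simp
  define r where "r n = inverse (real (Suc n))" for n
  have r: "0 < r n" "r \<longlonglongrightarrow> 0" for n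
    unfolding r_def[abs_def] by (simp, rule LIMSEQ_inverse_real_of_nat)
  have r_right: "filterlim r (at_right 0) sequentially"
    using r by (intro tendsto_imp_filterlim_at_right) auto
  have "AE y in \<mu>. 1 \<le> liminf (\<lambda>n. ennreal (measure \<mu> (ball y (r n)) * r n powr - t))"
    using dim[unfolded has_exact_dim_def] AE_measure_ball_pos[OF fm \<mu>(2), of r, OF r(1)]
  proof eventually_elim
    case (elim y)
    have "(\<lambda>n. ln (measure \<mu> (ball y (r n))) / ln (r n)) \<longlonglongrightarrow> \<alpha>"
      using filterlim_compose[OF elim(1) r_right] by (simp add: ball_real_eq)
    then have "\<forall>\<^sub>F n in sequentially. ln (measure \<mu> (ball y (r n))) / ln (r n) < t"
      by (rule order_tendstoD(2)) (rule t(1))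
    moreover have "\<forall>\<^sub>F n in sequentially. r n < 1" by (rule order_tendstoD(2)[OF r(2)]) simp
    ultimately have "\<forall>\<^sub>F n in sequentially. 1 \<le> ennreal (measure \<mu> (ball y (r n)) * r n powr - t)"
    proof eventually_elim
      case (elim n)
      let ?m = "measure \<mu> (ball y (r n))"
      have m: "0 < ?m" using \<open>\<forall>n. 0 < measure \<mu> (ball y (r n))\<close> by blast
      have "ln (r n) < 0" using elim(2) r(1) by simp
      then have "t * ln (r n) < ln ?m" using elim(1) by (simp add: divide_less_eq)
      then have "0 \<le> ln (?m * r n powr - t)"
        using m r(1)[of n] by (simp add: ln_mult ln_powr)
      moreover have "0 < ?m * r n powr - t" using m r(1)[of n] by simp
      ultimately show ?case by (simp add: ln_ge_zero_iff)
    qed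
    then show ?case by (intro Liminf_bounded)
  qed
  then have "(\<integral>\<^sup>+y. 1 \<partial>\<mu>) \<le> (\<integral>\<^sup>+y. liminf (\<lambda>n. ennreal (measure \<mu> (ball y (r n)) * r n powr - t)) \<partial>\<mu>)"
    by (rule nn_integral_mono_AE)
  also have "\<dots> \<le> liminf (\<lambda>n. \<integral>\<^sup>+y. ennreal (measure \<mu> (ball y (r n)) * r n powr - t) \<partial>\<mu>)"
    by (rule nn_integral_liminf) measurable
  also have "\<dots> \<le> liminf (\<lambda>n. ennreal (K * r n powr (s - t)))"
  proof (intro Liminf_mono always_eventually allI)
    fix n
    have "(\<integral>\<^sup>+y. ennreal (measure \<mu> (ball y (r n)) * r n powr - t) \<partial>\<mu>) =
        (\<integral>\<^sup>+y. ennreal (measure \<mu> (ball y (r n))) \<partial>\<mu>) * ennreal (r n powr - t)"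
      by (subst nn_integral_multc[symmetric]) (auto simp: ennreal_mult)
    also have "\<dots> \<le> ennreal (K * r n powr s) * ennreal (r n powr - t)"
      by (intro mult_right_mono corr r) simp
    also have "\<dots> = ennreal (K * r n powr (s - t))"
      by (simp add: ennreal_mult''[symmetric] powr_diff powr_minus divide_inverse mult.assoc)
    finally show "(\<integral>\<^sup>+y. ennreal (measure \<mu> (ball y (r n)) * r n powr - t) \<partial>\<mu>) \<le> ennreal (K * r n powr (s - t))" .
  qed
  also have "\<dots> = 0"
  proof -
    have "(\<lambda>n. K * r n powr (s - t)) \<longlonglongrightarrow> K * 0"
      using t r by (intro tendsto_intros tendsto_zero_powrI[OF r(2) tendsto_const]) (auto intro!: always_eventually less_imp_le)
    then have "(\<lambda>n. ennreal (K * r n powr (s - t))) \<longlonglongrightarrow> 0"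
      using tendsto_ennrealI by fastforce
    then show ?thesis by (intro lim_imp_Liminf) auto
  qed
  finally show False by (simp add: \<mu>.emeasure_space_1)
qed

text \<open>The probability that \<open>\<bar>y + X - X'\<bar> < r\<close> for an independent copy \<open>X'\<close> of \<open>X\<close>.\<close>
definition near :: "'a measure \<Rightarrow> ('a \<Rightarrow> real) \<Rightarrow> real \<Rightarrow> real \<Rightarrow> ennreal" where
  "near M X y r = (\<integral>\<^sup>+\<omega>. (\<integral>\<^sup>+\<eta>. indicator {-r<..<r} (y + X \<omega> - X \<eta>) \<partial>M) \<partial>M)"

lemma near_le_one:
  assumes "prob_space M"
  shows "near M X y r \<le> 1"
proof -
  interpret prob_space M by fact
  have "near M X y r \<le> (\<integral>\<^sup>+\<omega>. (\<integral>\<^sup>+\<eta>. 1 \<partial>M) \<partial>M)"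
    unfolding near_def by (intro nn_integral_mono) (auto split: split_indicator)
  then show ?thesis by (simp add: emeasure_space_1)
qed

lemma near_mono: "r \<le> s \<Longrightarrow> near M X y r \<le> near M X y s"
  unfolding near_def by (intro nn_integral_mono) (auto split: split_indicator)

definition window :: "real \<Rightarrow> real \<Rightarrow> real \<Rightarrow> ennreal" where
  "window w t z = indicator {t..<t + w} z"

lemma measurable_window [measurable]:
  assumes [measurable]: "f \<in> borel_measurable N" "g \<in> borel_measurable N"
  shows "(\<lambda>x. window w (f x) (g x)) \<in> borel_measurable N"
proof -
  have "(\<lambda>x. window w (f x) (g x)) = (\<lambda>x. if f x \<le> g x \<and> g x < f x + w then 1 else 0)"
    by (auto simp: window_def fun_eq_iff)
  then show ?thesis by simp
qed

text \<open>Let \<open>p t\<close> be the probability of \<open>X \<in> [t, t + 2 r)\<close>. Two points at distance below \<open>r\<close> share a set of such windows of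
  measure at least \<open>r\<close>, and points sharing any window are at distance below \<open>2 r\<close>. Hence the left-hand side is at
  most \<open>1 / r\<close> times \<open>\<integral> p (t - y) p t dt\<close>, which by the arithmetic-geometric mean inequality and translation invariance is
  largest for \<open>y = 0\<close>, and there it is at most \<open>2 r\<close> times the probability of distance below \<open>2 r\<close>.\<close>
lemma near_le_twice_near_zero:
  assumes M: "prob_space M" and X [measurable]: "X \<in> borel_measurable M" and r: "0 < r"
  shows "near M X y r \<le> 2 * near M X 0 (2 * r)"
proof -
  interpret prob_space M by fact
  interpret pair_sigma_finite M M ..
  interpret L: pair_sigma_finite lborel M ..
  define p where "p t = prob {\<omega> \<in> space M. t \<le> X \<omega> \<and> X \<omega> < t + 2 * r}" for t
  let ?I = "window (2 * r)"
  have p0: "0 \<le> p t" for t by (simp add: p_def)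
  have pI: "(\<integral>\<^sup>+\<omega>. ?I t (X \<omega>) \<partial>M) = ennreal (p t)" for t
  proof -
    have "(\<integral>\<^sup>+\<omega>. ?I t (X \<omega>) \<partial>M) = (\<integral>\<^sup>+\<omega>. indicator {\<omega> \<in> space M. t \<le> X \<omega> \<and> X \<omega> < t + 2 * r} \<omega> \<partial>M)"
      by (intro nn_integral_cong) (auto simp: window_def split: split_indicator)
    then show ?thesis by (simp add: p_def emeasure_eq_measure)
  qed
  have p_meas [measurable]: "p \<in> borel_measurable borel"
  proof -
    have "(\<lambda>t. enn2real (\<integral>\<^sup>+\<omega>. ?I t (X \<omega>) \<partial>M)) \<in> borel_measurable borel" by measurable
    then show ?thesis by (simp add: pI p0)
  qed
  \<comment> \<open>The windows containing both \<open>a\<close> and \<open>b\<close> start in an interval of length \<open>2 r - \<bar>a - b\<bar>\<close>.\<close>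
  have lower: "ennreal r * indicator {-r<..<r} (a - b) \<le> (\<integral>\<^sup>+t. ?I t a * ?I t b \<partial>lborel)" for a b
  proof (cases "\<bar>a - b\<bar> < r")
    case True
    have "ennreal r \<le> emeasure lborel {max a b - 2 * r<..min a b}"
      using True by (auto simp: max_def min_def intro!: ennreal_leI)
    also have "\<dots> = (\<integral>\<^sup>+t. indicator {max a b - 2 * r<..min a b} t \<partial>lborel)" by simp
    also have "\<dots> \<le> (\<integral>\<^sup>+t. ?I t a * ?I t b \<partial>lborel)"
      by (intro nn_integral_mono) (auto simp: window_def split: split_indicator)
    finally show ?thesis using True by (auto split: split_indicator)
  qed (auto split: split_indicator)
  have upper: "(\<integral>\<^sup>+t. ?I t a * ?I t b \<partial>lborel) \<le> ennreal (2 * r) * indicator {-(2*r)<..<2*r} (a - b)" for a b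
  proof -
    have "(\<integral>\<^sup>+t. ?I t a * ?I t b \<partial>lborel) \<le> (\<integral>\<^sup>+t. indicator {-(2*r)<..<2*r} (a - b) * indicator {a - 2 * r..a} t \<partial>lborel)"
      by (intro nn_integral_mono) (auto simp: window_def split: split_indicator)
    also have "\<dots> = indicator {-(2*r)<..<2*r} (a - b) * ennreal (2 * r)"
      using r by (subst nn_integral_cmult) auto
    finally show ?thesis by (simp add: mult.commute)
  qed
  have swap: "(\<integral>\<^sup>+\<omega>. \<integral>\<^sup>+\<eta>. \<integral>\<^sup>+t. ?I t (z + X \<omega>) * ?I t (X \<eta>) \<partial>lborel \<partial>M \<partial>M) = (\<integral>\<^sup>+t. ennreal (p (t - z) * p t) \<partial>lborel)" for z
  proof -
    have "(\<integral>\<^sup>+\<omega>. \<integral>\<^sup>+\<eta>. \<integral>\<^sup>+t. ?I t (z + X \<omega>) * ?I t (X \<eta>) \<partial>lborel \<partial>M \<partial>M) =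
        (\<integral>\<^sup>+\<omega>. \<integral>\<^sup>+t. \<integral>\<^sup>+\<eta>. ?I t (z + X \<omega>) * ?I t (X \<eta>) \<partial>M \<partial>lborel \<partial>M)"
      by (intro nn_integral_cong L.Fubini') measurable
    also have "\<dots> = (\<integral>\<^sup>+\<omega>. \<integral>\<^sup>+t. ?I t (z + X \<omega>) * ennreal (p t) \<partial>lborel \<partial>M)"
      by (intro nn_integral_cong) (simp add: nn_integral_cmult pI)
    also have "\<dots> = (\<integral>\<^sup>+t. \<integral>\<^sup>+\<omega>. ?I t (z + X \<omega>) * ennreal (p t) \<partial>M \<partial>lborel)"
      by (rule L.Fubini') measurable
    also have "\<dots> = (\<integral>\<^sup>+t. (\<integral>\<^sup>+\<omega>. ?I (t - z) (X \<omega>) \<partial>M) * ennreal (p t) \<partial>lborel)"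
    proof (rule nn_integral_cong)
      fix t
      have "?I t (z + X \<omega>) = ?I (t - z) (X \<omega>)" for \<omega> by (auto simp: window_def split: split_indicator)
      then show "(\<integral>\<^sup>+\<omega>. ?I t (z + X \<omega>) * ennreal (p t) \<partial>M) = (\<integral>\<^sup>+\<omega>. ?I (t - z) (X \<omega>) \<partial>M) * ennreal (p t)"
        by (simp add: nn_integral_multc)
    qed
    finally show ?thesis by (simp add: pI ennreal_mult p0)
  qed
  have "ennreal r * near M X y r = (\<integral>\<^sup>+\<omega>. \<integral>\<^sup>+\<eta>. ennreal r * indicator {-r<..<r} (y + X \<omega> - X \<eta>) \<partial>M \<partial>M)"
    unfolding near_def by (simp add: nn_integral_cmult)
  also have "\<dots> \<le> (\<integral>\<^sup>+\<omega>. \<integral>\<^sup>+\<eta>. \<integral>\<^sup>+t. ?I t (y + X \<omega>) * ?I t (X \<eta>) \<partial>lborel \<partial>M \<partial>M)"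
    by (intro nn_integral_mono lower)
  also have "\<dots> = (\<integral>\<^sup>+t. ennreal (p (t - y) * p t) \<partial>lborel)" by (rule swap)
  also have "\<dots> \<le> (\<integral>\<^sup>+t. ennreal (1/2) * ennreal (p (t - y) * p (t - y)) + ennreal (1/2) * ennreal (p t * p t) \<partial>lborel)"
  proof (rule nn_integral_mono)
    fix t
    have "p (t - y) * p t \<le> 1/2 * (p (t - y) * p (t - y)) + 1/2 * (p t * p t)"
      using zero_le_square[of "p (t - y) - p t"] by (simp add: algebra_simps)
    then have "ennreal (p (t - y) * p t) \<le> ennreal (1/2 * (p (t - y) * p (t - y)) + 1/2 * (p t * p t))"
      by (rule ennreal_leI)
    also have "\<dots> = ennreal (1/2) * ennreal (p (t - y) * p (t - y)) + ennreal (1/2) * ennreal (p t * p t)"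
    proof -
      have e: "ennreal (1/2 * (a * a)) = ennreal (1/2) * ennreal (a * a)" for a :: real
        by (rule ennreal_mult) auto
      show ?thesis unfolding e[symmetric] by (rule ennreal_plus) auto
    qed
    finally show "ennreal (p (t - y) * p t) \<le> ennreal (1/2) * ennreal (p (t - y) * p (t - y)) + ennreal (1/2) * ennreal (p t * p t)" .
  qed
  also have "\<dots> = ennreal (1/2) * (\<integral>\<^sup>+t. ennreal (p (t - y) * p (t - y)) \<partial>lborel) + ennreal (1/2) * (\<integral>\<^sup>+t. ennreal (p t * p t) \<partial>lborel)"
    by (subst nn_integral_add) (auto simp: nn_integral_cmult)
  also have "(\<integral>\<^sup>+t. ennreal (p (t - y) * p (t - y)) \<partial>lborel) = (\<integral>\<^sup>+t. ennreal (p t * p t) \<partial>lborel)"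
    using nn_integral_real_affine[of "\<lambda>t. ennreal (p t * p t)" 1 "- y"] by (simp add: add.commute)
  also have "ennreal (1/2) * (\<integral>\<^sup>+t. ennreal (p t * p t) \<partial>lborel) + ennreal (1/2) * (\<integral>\<^sup>+t. ennreal (p t * p t) \<partial>lborel) =
      (\<integral>\<^sup>+t. ennreal (p (t - 0) * p t) \<partial>lborel)"
    by (subst distrib_right[symmetric], subst ennreal_plus[symmetric]) auto
  also have "\<dots> = (\<integral>\<^sup>+\<omega>. \<integral>\<^sup>+\<eta>. \<integral>\<^sup>+t. ?I t (0 + X \<omega>) * ?I t (X \<eta>) \<partial>lborel \<partial>M \<partial>M)"
    by (rule swap[symmetric])
  also have "\<dots> \<le> (\<integral>\<^sup>+\<omega>. \<integral>\<^sup>+\<eta>. ennreal (2 * r) * indicator {-(2*r)<..<2*r} (0 + X \<omega> - X \<eta>) \<partial>M \<partial>M)"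
    by (intro nn_integral_mono upper)
  also have "\<dots> = ennreal (2 * r) * near M X 0 (2 * r)"
    unfolding near_def by (simp add: nn_integral_cmult)
  also have "\<dots> = ennreal r * (2 * near M X 0 (2 * r))"
    using r by (simp add: ennreal_mult' mult.assoc mult.left_commute)
  finally show ?thesis
    using r by (simp add: ennreal_mult_le_mult_iff)
qed

text \<open>Condition on the digits at even places. What remains is the difference of two independent digit sums in base
  \<open>\<beta>\<^sup>2\<close>, shifted by a constant.\<close>
lemma near_digit_sum_square:
  assumes \<beta>: "1 < \<beta>" and r: "0 < r"
  shows "near coin_space (digit_sum \<beta>) 0 r \<le> 2 * near coin_space (digit_sum (\<beta>\<^sup>2)) 0 (2 * r)"
proof -
  let ?x = "digit_sum (\<beta>\<^sup>2)"
  let ?C = "coin_space"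
  have split: "(\<integral>\<^sup>+\<zeta>. g \<zeta> \<partial>?C) = (\<integral>\<^sup>+\<eta>. \<integral>\<^sup>+\<omega>. g (interleave \<omega> \<eta>) \<partial>?C \<partial>?C)"
    if [measurable]: "g \<in> borel_measurable ?C" for g
  proof -
    have "(\<integral>\<^sup>+\<zeta>. g \<zeta> \<partial>?C) = (\<integral>\<^sup>+\<zeta>. g \<zeta> \<partial>distr (?C \<Otimes>\<^sub>M ?C) ?C (\<lambda>(\<omega>, \<eta>). interleave \<omega> \<eta>))"
      by (simp add: distr_interleave)
    also have "\<dots> = (\<integral>\<^sup>+z. g (case z of (\<omega>, \<eta>) \<Rightarrow> interleave \<omega> \<eta>) \<partial>(?C \<Otimes>\<^sub>M ?C))"
      by (rule nn_integral_distr) measurable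
    also have "\<dots> = (\<integral>\<^sup>+z. (case z of (\<omega>, \<eta>) \<Rightarrow> g (interleave \<omega> \<eta>)) \<partial>(?C \<Otimes>\<^sub>M ?C))"
      by (simp add: case_prod_beta)
    also have "\<dots> = (\<integral>\<^sup>+\<eta>. \<integral>\<^sup>+\<omega>. g (interleave \<omega> \<eta>) \<partial>?C \<partial>?C)"
    proof (subst coin_pair.nn_integral_snd[symmetric])
      have "(\<lambda>z. g (case z of (\<omega>, \<eta>) \<Rightarrow> interleave \<omega> \<eta>)) \<in> borel_measurable (?C \<Otimes>\<^sub>M ?C)" by measurable
      then show "(\<lambda>(\<omega>, \<eta>). g (interleave \<omega> \<eta>)) \<in> borel_measurable (?C \<Otimes>\<^sub>M ?C)" by (simp add: case_prod_beta)
    qed simp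
    finally show ?thesis .
  qed
  have "near ?C (digit_sum \<beta>) 0 r = (\<integral>\<^sup>+\<eta>. \<integral>\<^sup>+\<omega>. \<integral>\<^sup>+\<eta>'. \<integral>\<^sup>+\<omega>'.
      indicator {-r<..<r} (\<beta> * (?x \<eta> - ?x \<eta>') + ?x \<omega> - ?x \<omega>') \<partial>?C \<partial>?C \<partial>?C \<partial>?C)"
    unfolding near_def
    by (subst split, measurable, subst split, measurable) (simp add: digit_sum_interleave[OF \<beta>] algebra_simps)
  also have "\<dots> = (\<integral>\<^sup>+\<eta>. \<integral>\<^sup>+\<eta>'. near ?C ?x (\<beta> * (?x \<eta> - ?x \<eta>')) r \<partial>?C \<partial>?C)"
    unfolding near_def by (intro nn_integral_cong coin_pair.Fubini') measurable
  also have "\<dots> \<le> (\<integral>\<^sup>+\<eta>. \<integral>\<^sup>+\<eta>'. 2 * near ?C ?x 0 (2 * r) \<partial>?C \<partial>?C)"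
    by (intro nn_integral_mono near_le_twice_near_zero prob_space_coin_space measurable_digit_sum r)
  also have "\<dots> = 2 * near ?C ?x 0 (2 * r)"
    using coin.emeasure_space_1 by simp
  finally show ?thesis .
qed

text \<open>Splitting off both first digits: their difference is \<open>-1, 0, 1\<close> with probabilities 1/4, 1/2, 1/4.\<close>
lemma near_digit_sum_step:
  assumes \<beta>: "1 < \<beta>"
  shows "near coin_space (digit_sum \<beta>) y (r / \<beta>) =
    ennreal (1/4) * near coin_space (digit_sum \<beta>) (\<beta> * y - 1) r + ennreal (1/2) * near coin_space (digit_sum \<beta>) (\<beta> * y) r
    + ennreal (1/4) * near coin_space (digit_sum \<beta>) (\<beta> * y + 1) r"
proof -
  let ?x = "digit_sum \<beta>"
  let ?C = "coin_space"
  have ind: "indicator {-(r/\<beta>)<..<r/\<beta>} (y + (a + u) / \<beta> - (b + v) / \<beta>) =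
      (indicator {-r<..<r} ((\<beta> * y + (a - b)) + u - v) :: ennreal)" for a b u v
  proof -
    have "y + (a + u) / \<beta> - (b + v) / \<beta> = ((\<beta> * y + (a - b)) + u - v) / \<beta>" using \<beta> by (simp add: field_simps)
    moreover have "w / \<beta> \<in> {-(r/\<beta>)<..<r/\<beta>} \<longleftrightarrow> w \<in> {-r<..<r}" for w
      using \<beta> unfolding minus_divide_left by (simp add: divide_less_cancel del: divide_minus_left)
    ultimately show ?thesis by (auto split: split_indicator)
  qed
  have 1: "(\<integral>\<^sup>+\<eta>. indicator {-(r/\<beta>)<..<r/\<beta>} (y + ?x \<omega> - ?x \<eta>) \<partial>?C) =
     ennreal (1/2) * (\<integral>\<^sup>+\<eta>. indicator {-(r/\<beta>)<..<r/\<beta>} (y + ?x \<omega> - (1 + ?x \<eta>) / \<beta>) \<partial>?C) +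
     ennreal (1/2) * (\<integral>\<^sup>+\<eta>. indicator {-(r/\<beta>)<..<r/\<beta>} (y + ?x \<omega> - (0 + ?x \<eta>) / \<beta>) \<partial>?C)" for \<omega>
    by (subst nn_integral_coin_space_first, measurable) (simp add: digit_sum_case_nat[OF \<beta>] divide_ennreal_def)
  have 2: "(\<integral>\<^sup>+\<omega>. (\<integral>\<^sup>+\<eta>. indicator {-(r/\<beta>)<..<r/\<beta>} (y + ?x \<omega> - (b + ?x \<eta>) / \<beta>) \<partial>?C) \<partial>?C) =
     ennreal (1/2) * near ?C ?x (\<beta> * y + (1 - b)) r + ennreal (1/2) * near ?C ?x (\<beta> * y + (0 - b)) r" for b
    unfolding near_def ind[symmetric]
    by (subst nn_integral_coin_space_first, measurable) (simp add: digit_sum_case_nat[OF \<beta>] divide_ennreal_def)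
  have meas: "(\<lambda>\<omega>. \<integral>\<^sup>+\<eta>. indicator {-(r/\<beta>)<..<r/\<beta>} (y + ?x \<omega> - (b + ?x \<eta>) / \<beta>) \<partial>?C) \<in> borel_measurable ?C" for b
    by measurable
  have "near ?C ?x y (r / \<beta>) = (\<integral>\<^sup>+\<omega>. 
     ennreal (1/2) * (\<integral>\<^sup>+\<eta>. indicator {-(r/\<beta>)<..<r/\<beta>} (y + ?x \<omega> - (1 + ?x \<eta>) / \<beta>) \<partial>?C) +
     ennreal (1/2) * (\<integral>\<^sup>+\<eta>. indicator {-(r/\<beta>)<..<r/\<beta>} (y + ?x \<omega> - (0 + ?x \<eta>) / \<beta>) \<partial>?C) \<partial>?C)"
    unfolding near_def 1 ..
  also have "\<dots> = 
     ennreal (1/2) * (\<integral>\<^sup>+\<omega>. (\<integral>\<^sup>+\<eta>. indicator {-(r/\<beta>)<..<r/\<beta>} (y + ?x \<omega> - (1 + ?x \<eta>) / \<beta>) \<partial>?C) \<partial>?C) +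
     ennreal (1/2) * (\<integral>\<^sup>+\<omega>. (\<integral>\<^sup>+\<eta>. indicator {-(r/\<beta>)<..<r/\<beta>} (y + ?x \<omega> - (0 + ?x \<eta>) / \<beta>) \<partial>?C) \<partial>?C)"
    by (simp only: nn_integral_add nn_integral_cmult borel_measurable_times_ennreal measurable_const meas borel_measurable_const)
  also have "\<dots> = ennreal (1/2) * (ennreal (1/2) * near ?C ?x (\<beta> * y) r + ennreal (1/2) * near ?C ?x (\<beta> * y - 1) r)
      + ennreal (1/2) * (ennreal (1/2) * near ?C ?x (\<beta> * y + 1) r + ennreal (1/2) * near ?C ?x (\<beta> * y) r)"
    unfolding 2 by simp
  also have "\<dots> = (ennreal (1/2) * ennreal (1/2)) * near ?C ?x (\<beta> * y - 1) r
      + (ennreal (1/2) * ennreal (1/2) + ennreal (1/2) * ennreal (1/2)) * near ?C ?x (\<beta> * y) r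
      + (ennreal (1/2) * ennreal (1/2)) * near ?C ?x (\<beta> * y + 1) r"
    by (simp only: distrib_left distrib_right mult.assoc add.assoc add.commute add.left_commute)
  also have "ennreal (1/2) * ennreal (1/2) = ennreal (1/4)" by (subst ennreal_mult[symmetric]) auto
  also have "ennreal (1/4) + ennreal (1/4) = ennreal (1/2)" by (subst ennreal_plus[symmetric]) auto
  finally show ?thesis .
qed

section \<open>Supersolutions given by integer step functions\<close>
fun lookup :: "int list \<Rightarrow> int \<Rightarrow> int" where
  "lookup [] i = 0"
| "lookup (v # vs) i = (if i \<le> 0 then v else lookup vs (i - 1))"

text \<open>A list \<open>vs\<close> encodes the even function with value \<open>lookup vs j\<close> for \<open>j \<le> 32 \<bar>y\<bar> < j + 1\<close>. Let \<open>j\<close> be the cell of \<open>y \<ge> 0\<close>.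
  For every parameter in \<open>[p / 100, q / 100]\<close> the three indices are lower bounds for the cells of
  \<open>\<gamma> y - 1\<close>, \<open>\<gamma> y\<close> and \<open>\<gamma> y + 1\<close>, so for a nonincreasing list the values there are upper bounds. The
  inequality is the supersolution property with factor \<open>a / 1000\<close>, multiplied by 4000. The two expressions
  under the maximum belong to \<open>\<gamma> y \<ge> 1\<close> and \<open>\<gamma> y \<le> 1\<close>; an expression of the wrong sign is harmless.\<close>
definition cell_ok :: "int \<Rightarrow> int \<Rightarrow> int \<Rightarrow> int list \<Rightarrow> int \<Rightarrow> int \<Rightarrow> bool" where
  "cell_ok p q a vs j v \<longleftrightarrow>
     1000 * (lookup vs (max ((p * j - 3200) div 100) ((3200 - q * (j + 1)) div 100))
       + 2 * lookup vs (p * j div 100) + lookup vs (p * j div 100 + 32)) \<le> 4 * a * v"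

text \<open>Monotonicity is checked between neighbours; at the end of the list the neighbour counts as 0, which is the
  value of the step function beyond its support.\<close>
fun cells_ok :: "int \<Rightarrow> int \<Rightarrow> int \<Rightarrow> int list \<Rightarrow> int \<Rightarrow> int list \<Rightarrow> bool" where
  "cells_ok p q a vs j [] = True"
| "cells_ok p q a vs j (w # ws) \<longleftrightarrow> 1 \<le> w \<and> lookup ws 0 \<le> w \<and> cell_ok p q a vs j w \<and> cells_ok p q a vs (j + 1) ws"

text \<open>The third condition says that the support of the step function, of half-width \<open>length vs / 32\<close>, contains
  \<open>[-1 / (\<gamma> - 1), 1 / (\<gamma> - 1)]\<close> in its interior; outside this interval the walk \<open>y \<mapsto> \<gamma> y + \<epsilon>\<close> escapes. The
  fifth is \<open>a / 1000 \<le> (q / 100) powr -0.82\<close>, raised to the power 50, where \<open>0.82 = 41 / 50\<close>.\<close>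
definition certificate :: "int \<Rightarrow> int \<Rightarrow> int \<Rightarrow> int list \<Rightarrow> bool" where
  "certificate p q a vs \<longleftrightarrow> 100 < p \<and> p \<le> q \<and> 3200 < (p - 100) * int (length vs) \<and> 0 < a \<and>
     a ^ 50 * q ^ 41 \<le> 1000 ^ 50 * 100 ^ 41 \<and> cells_ok p q a vs 0 vs"

definition step_function :: "int list \<Rightarrow> real \<Rightarrow> real" where
  "step_function vs y = real_of_int (lookup vs \<lfloor>32 * \<bar>y\<bar>\<rfloor>)"

lemma lookup_outside: "int (length vs) \<le> i \<Longrightarrow> lookup vs i = 0"
  by (induction vs arbitrary: i) auto

lemma lookup_nonneg: "cells_ok p q a us j vs \<Longrightarrow> 0 \<le> lookup vs i"
  by (induction vs arbitrary: i j) auto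

lemma lookup_ge_one: "cells_ok p q a us j vs \<Longrightarrow> 0 \<le> i \<Longrightarrow> i < int (length vs) \<Longrightarrow> 1 \<le> lookup vs i"
proof (induction vs arbitrary: i j)
  case (Cons v vs)
  show ?case
  proof (cases "i \<le> 0")
    case False
    then show ?thesis using Cons.prems Cons.IH[of "j + 1" "i - 1"] by simp
  qed (use Cons.prems in simp)
qed simp

lemma lookup_antimono: "cells_ok p q a us j vs \<Longrightarrow> i \<le> k \<Longrightarrow> lookup vs k \<le> lookup vs i"
proof (induction vs arbitrary: i j k)
  case (Cons v vs)
  consider "k \<le> 0" | "i \<le> 0" "0 < k" | "0 < i" using Cons.prems by linarith
  then show ?case
  proof cases
    case 2
    then show ?thesis using Cons.prems Cons.IH[of "j + 1" 0 "k - 1"] by simp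
  next
    case 3
    then show ?thesis using Cons.prems Cons.IH[of "j + 1" "i - 1" "k - 1"] by simp
  qed (use Cons.prems in simp)
qed simp

lemma cells_ok_cell:
  "cells_ok p q a us j vs \<Longrightarrow> 0 \<le> i \<Longrightarrow> i < int (length vs) \<Longrightarrow> cell_ok p q a us (j + i) (lookup vs i)"
proof (induction vs arbitrary: i j)
  case (Cons v vs)
  show ?case
  proof (cases "i = 0")
    case False
    then show ?thesis using Cons.prems Cons.IH[of "j + 1" "i - 1"] by simp
  qed (use Cons.prems in simp)
qed simp

lemma of_int_div_le: "0 < m \<Longrightarrow> real_of_int (k div m) \<le> real_of_int k / real_of_int m"
  using of_int_floor_le[of "real_of_int k / real_of_int m"] unfolding floor_divide_of_int_eq .

text \<open>By evenness it suffices to consider \<open>y \<ge> 0\<close>. Outside the support both sides vanish, since there a step of the walk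
  leads further out.\<close>
lemma certificate_supersolution:
  assumes cert: "certificate p q a vs" and \<gamma>: "real_of_int p / 100 \<le> \<gamma>" "\<gamma> \<le> real_of_int q / 100"
  defines "\<psi> \<equiv> step_function vs"
  shows "1/4 * \<psi> (\<gamma> * y - 1) + 1/2 * \<psi> (\<gamma> * y) + 1/4 * \<psi> (\<gamma> * y + 1) \<le> real_of_int a / 1000 * \<psi> y"
proof -
  have c: "100 < p" "3200 < (p - 100) * int (length vs)" "0 < a" "cells_ok p q a vs 0 vs"
    using cert unfolding certificate_def by blast+
  have bound: "\<psi> z \<le> real_of_int (lookup vs m)" if "real_of_int m \<le> 32 * \<bar>z\<bar>" for m z
    using that lookup_antimono[OF c(4), of m "\<lfloor>32 * \<bar>z\<bar>\<rfloor>"] by (simp add: \<psi>_def step_function_def le_floor_iff)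
  have nonneg: "1/4 * \<psi> (\<gamma> * y - 1) + 1/2 * \<psi> (\<gamma> * y) + 1/4 * \<psi> (\<gamma> * y + 1) \<le> real_of_int a / 1000 * \<psi> y"
    if y: "0 \<le> y" for y
  proof -
    define j where "j = \<lfloor>32 * y\<rfloor>"
    have j: "real_of_int j \<le> 32 * y" "32 * y < real_of_int j + 1" "0 \<le> j"
      using y by (auto simp: j_def)
    have \<psi>y: "\<psi> y = real_of_int (lookup vs j)" using y by (simp add: \<psi>_def step_function_def j_def)
    have \<gamma>1: "1 < \<gamma>" using \<gamma>(1) c(1) by linarith
    have \<gamma>y: "real_of_int (p * j) / 100 \<le> 32 * (\<gamma> * y)"
    proof -
      have "real_of_int p / 100 * real_of_int j \<le> \<gamma> * (32 * y)"
        using \<gamma>(1) \<gamma>1 j by (intro mult_mono) auto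
      then show ?thesis by simp
    qed
    show ?thesis
    proof (cases "j < int (length vs)")
      case True
      let ?l = "lookup vs (max ((p * j - 3200) div 100) ((3200 - q * (j + 1)) div 100))"
      have "real_of_int ((p * j - 3200) div 100) \<le> 32 * \<bar>\<gamma> * y - 1\<bar>"
        using of_int_div_le[of 100 "p * j - 3200"] \<gamma>y abs_ge_self[of "\<gamma> * y - 1"] by (simp add: diff_divide_distrib)
      moreover have "real_of_int ((3200 - q * (j + 1)) div 100) \<le> 32 * \<bar>\<gamma> * y - 1\<bar>"
      proof -
        have "\<gamma> * (32 * y) \<le> real_of_int q / 100 * (real_of_int j + 1)"
          using \<gamma> \<gamma>1 y j by (intro mult_mono) auto
        then have "32 * (\<gamma> * y) \<le> real_of_int (q * (j + 1)) / 100" by simp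
        then show ?thesis
          using of_int_div_le[of 100 "3200 - q * (j + 1)"] abs_ge_minus_self[of "\<gamma> * y - 1"] by (simp add: diff_divide_distrib)
      qed
      ultimately have 1: "\<psi> (\<gamma> * y - 1) \<le> real_of_int ?l" by (intro bound) (simp add: max_def)
      have 2: "\<psi> (\<gamma> * y) \<le> real_of_int (lookup vs (p * j div 100))"
        using of_int_div_le[of 100 "p * j"] \<gamma>y by (intro bound) simp
      have 3: "\<psi> (\<gamma> * y + 1) \<le> real_of_int (lookup vs (p * j div 100 + 32))"
        using of_int_div_le[of 100 "p * j"] \<gamma>y abs_ge_self[of "\<gamma> * y + 1"] by (intro bound) simp
      have "cell_ok p q a vs j (lookup vs j)"
        using cells_ok_cell[OF c(4) j(3) True] by simp
      then have "real_of_int (1000 * (?l + 2 * lookup vs (p * j div 100) + lookup vs (p * j div 100 + 32))) \<le>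
          real_of_int (4 * a * lookup vs j)"
        unfolding cell_ok_def of_int_le_iff .
      then show ?thesis using 1 2 3 by (simp add: \<psi>y)
    next
      case False
      let ?N = "int (length vs)"
      have "real_of_int 3200 < real_of_int ((p - 100) * ?N)" using c(2) by (simp only: of_int_less_iff)
      then have "32 < (real_of_int p / 100 - 1) * real_of_int ?N" by (simp add: field_simps)
      also have "\<dots> \<le> (\<gamma> - 1) * (32 * y)"
        using \<gamma>(1) \<gamma>1 False j by (intro mult_mono) auto
      finally have far: "32 + 32 * y < 32 * (\<gamma> * y)" by (simp add: algebra_simps)
      have zero: "\<psi> z \<le> 0" if "32 * y \<le> 32 * \<bar>z\<bar>" for z
        using bound[of ?N z] that False j by (simp add: lookup_outside)
      have "\<psi> (\<gamma> * y - 1) \<le> 0" "\<psi> (\<gamma> * y) \<le> 0" "\<psi> (\<gamma> * y + 1) \<le> 0"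
        using far by (auto intro!: zero)
      moreover have "0 \<le> real_of_int a / 1000 * \<psi> y"
        using c(3) lookup_nonneg[OF c(4), of j] by (simp add: \<psi>y)
      ultimately show ?thesis by linarith
    qed
  qed
  have even: "\<psi> (- z) = \<psi> z" for z by (simp add: \<psi>_def step_function_def)
  show ?thesis
  proof (cases "0 \<le> y")
    case False
    have "\<psi> (\<gamma> * - y - 1) = \<psi> (\<gamma> * y + 1)" "\<psi> (\<gamma> * - y) = \<psi> (\<gamma> * y)" "\<psi> (\<gamma> * - y + 1) = \<psi> (\<gamma> * y - 1)"
      using even[of "\<gamma> * y + 1"] even[of "\<gamma> * y"] even[of "\<gamma> * y - 1"] by simp_all
    then show ?thesis using nonneg[of "- y"] False even[of y] by simp
  qed (rule nonneg)
qed

text \<open>Induction along \<open>near_digit_sum_step\<close>. At the start \<open>near\<close> is at most 1, and it vanishes for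
  \<open>\<bar>y\<bar> \<ge> 1 / (\<beta> - 1) + c\<close>, because two digit sums differ by at most \<open>1 / (\<beta> - 1)\<close>.\<close>
lemma near_digit_sum_decay:
  assumes \<beta>: "1 < \<beta>" and \<psi>: "\<And>y. 0 \<le> \<psi> y" "\<And>y. \<bar>y\<bar> < 1 / (\<beta> - 1) + c \<Longrightarrow> 1 \<le> \<psi> y"
    and \<rho>: "0 \<le> \<rho>" "\<And>y. 1/4 * \<psi> (\<beta> * y - 1) + 1/2 * \<psi> (\<beta> * y) + 1/4 * \<psi> (\<beta> * y + 1) \<le> \<rho> * \<psi> y"
  shows "near coin_space (digit_sum \<beta>) y (c / \<beta> ^ n) \<le> ennreal (\<rho> ^ n * \<psi> y)"
proof (induction n arbitrary: y)
  case 0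
  show ?case
  proof (cases "\<bar>y\<bar> < 1 / (\<beta> - 1) + c")
    case True
    have "near coin_space (digit_sum \<beta>) y c \<le> 1" by (rule near_le_one[OF prob_space_coin_space])
    also have "1 \<le> ennreal (\<psi> y)" using \<psi>(2)[OF True] by simp
    finally show ?thesis by simp
  next
    case False
    have "\<not> (-c < y + digit_sum \<beta> \<omega> - digit_sum \<beta> \<eta> \<and> y + digit_sum \<beta> \<omega> - digit_sum \<beta> \<eta> < c)" for \<omega> \<eta>
      using digit_sum_bounds[OF \<beta>, of \<omega>] digit_sum_bounds[OF \<beta>, of \<eta>] False by auto
    then have "near coin_space (digit_sum \<beta>) y c = 0" unfolding near_def by simp
    then show ?thesis by simp
  qed
next
  case (Suc n)
  let ?near = "near coin_space (digit_sum \<beta>)"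
  have "?near y (c / \<beta> ^ Suc n) = ?near y (c / \<beta> ^ n / \<beta>)" by (simp add: mult.commute)
  also have "\<dots> = ennreal (1/4) * ?near (\<beta> * y - 1) (c / \<beta> ^ n) + ennreal (1/2) * ?near (\<beta> * y) (c / \<beta> ^ n)
      + ennreal (1/4) * ?near (\<beta> * y + 1) (c / \<beta> ^ n)"
    by (rule near_digit_sum_step[OF \<beta>])
  also have "\<dots> \<le> ennreal (1/4) * ennreal (\<rho> ^ n * \<psi> (\<beta> * y - 1)) + ennreal (1/2) * ennreal (\<rho> ^ n * \<psi> (\<beta> * y))
      + ennreal (1/4) * ennreal (\<rho> ^ n * \<psi> (\<beta> * y + 1))"
    by (intro add_mono mult_left_mono Suc.IH) auto
  also have "\<dots> = ennreal (1/4 * (\<rho> ^ n * \<psi> (\<beta> * y - 1)) + 1/2 * (\<rho> ^ n * \<psi> (\<beta> * y)) + 1/4 * (\<rho> ^ n * \<psi> (\<beta> * y + 1)))"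
  proof -
    have e: "ennreal k * ennreal (\<rho> ^ n * \<psi> z) = ennreal (k * (\<rho> ^ n * \<psi> z))" if "0 \<le> k" for k z
      using that \<psi>(1) \<rho>(1) by (intro ennreal_mult[symmetric]) auto
    have pos: "0 \<le> k * (\<rho> ^ n * \<psi> z)" if "0 \<le> k" for k z
      using that \<psi>(1) \<rho>(1) by auto
    show ?thesis
      using pos[of "1/4" "\<beta> * y - 1"] pos[of "1/2" "\<beta> * y"] pos[of "1/4" "\<beta> * y + 1"]
      by (subst (1 2 3) e) (auto simp: ennreal_plus[symmetric] simp del: ennreal_plus)
  qed
  also have "\<dots> \<le> ennreal (\<rho> ^ Suc n * \<psi> y)"
  proof (rule ennreal_leI)
    have "\<rho> ^ n * (1/4 * \<psi> (\<beta> * y - 1) + 1/2 * \<psi> (\<beta> * y) + 1/4 * \<psi> (\<beta> * y + 1)) \<le> \<rho> ^ n * (\<rho> * \<psi> y)"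
      using \<rho> by (intro mult_left_mono) auto
    then show "1/4 * (\<rho> ^ n * \<psi> (\<beta> * y - 1)) + 1/2 * (\<rho> ^ n * \<psi> (\<beta> * y)) + 1/4 * (\<rho> ^ n * \<psi> (\<beta> * y + 1)) \<le> \<rho> ^ Suc n * \<psi> y"
      by (simp add: algebra_simps)
  qed
  finally show ?case .
qed

lemma near_power_bound:
  assumes \<beta>: "1 < \<beta>" and c: "0 < c" and s: "0 \<le> s" and A: "0 \<le> A"
    and decay: "\<And>n. near coin_space (digit_sum \<beta>) 0 (c / \<beta> ^ n) \<le> ennreal (A * (\<beta> powr - s) ^ n)"
  obtains K where "\<And>r. 0 < r \<Longrightarrow> near coin_space (digit_sum \<beta>) 0 r \<le> ennreal (K * r powr s)"
proof
  define K where "K = (A + 1) * (\<beta> / c) powr s"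
  fix r :: real assume r: "0 < r"
  have split: "(\<beta> / c * r) powr s = (\<beta> / c) powr s * r powr s"
    by (rule powr_mult)
  show "near coin_space (digit_sum \<beta>) 0 r \<le> ennreal (K * r powr s)"
  proof (cases "r < c")
    case True
    define n where "n = nat \<lfloor>log \<beta> (c / r)\<rfloor>"
    have "0 \<le> log \<beta> (c / r)" using True r \<beta> c by (simp add: zero_le_log_cancel_iff)
    then have n: "real n \<le> log \<beta> (c / r)" "log \<beta> (c / r) < real n + 1" by (simp_all add: n_def)
    have "\<beta> powr real n \<le> c / r" using n(1) \<beta> c r by (simp add: le_log_iff)
    then have r_le: "r \<le> c / \<beta> ^ n" using \<beta> r by (simp add: powr_realpow field_simps)
    have "c / r < \<beta> powr (real n + 1)" using n(2) \<beta> c r by (simp add: log_less_iff)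
    then have r_gt: "1 / \<beta> ^ n \<le> \<beta> / c * r"
      using \<beta> r c by (simp add: powr_add powr_realpow field_simps)
    have "near coin_space (digit_sum \<beta>) 0 r \<le> ennreal (A * (\<beta> powr - s) ^ n)"
      using near_mono[OF r_le] decay by (rule order_trans)
    also have "A * (\<beta> powr - s) ^ n \<le> (A + 1) * (\<beta> / c * r) powr s"
    proof (rule mult_mono)
      have inv: "1 / \<beta> ^ n = \<beta> powr (- real n)"
        using \<beta> by (simp add: powr_minus powr_realpow divide_inverse)
      have "(\<beta> powr - s) ^ n = \<beta> powr (- s * real n)"
        using \<beta> by (subst powr_power) (simp_all add: mult.commute)
      also have "\<dots> = (1 / \<beta> ^ n) powr s"
        unfolding inv powr_powr by (simp add: mult.commute)
      also have "\<dots> \<le> (\<beta> / c * r) powr s" using r_gt s \<beta> by (intro powr_mono2) auto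
      finally show "(\<beta> powr - s) ^ n \<le> (\<beta> / c * r) powr s" .
    qed (use A in auto)
    also have "(A + 1) * (\<beta> / c * r) powr s = K * r powr s"
      unfolding K_def split by simp
    finally show ?thesis by (simp add: ennreal_leI)
  next
    case False
    have "1 \<le> (\<beta> / c * r) powr s"
    proof (rule ge_one_powr_ge_zero)
      have "1 * c \<le> \<beta> * r" using False \<beta> c by (intro mult_mono) auto
      then show "1 \<le> \<beta> / c * r" using c by (simp add: field_simps)
    qed (rule s)
    then have "1 * 1 \<le> (A + 1) * (\<beta> / c * r) powr s" using A by (intro mult_mono) auto
    also have "\<dots> = K * r powr s" unfolding K_def split by simp
    finally have "1 \<le> ennreal (K * r powr s)" by simp
    then show ?thesis using near_le_one[OF prob_space_coin_space] order_trans by blast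
  qed
qed

lemma near_bound_of_certificate:
  assumes cert: "certificate p q a vs" and \<beta>: "real_of_int p / 100 \<le> \<beta>" "\<beta> \<le> real_of_int q / 100"
  obtains K where "\<And>r. 0 < r \<Longrightarrow> near coin_space (digit_sum \<beta>) 0 r \<le> ennreal (K * r powr 0.82)"
proof -
  have ce: "100 < p" "p \<le> q" "3200 < (p - 100) * int (length vs)" "0 < a"
    "a ^ 50 * q ^ 41 \<le> 1000 ^ 50 * 100 ^ 41" "cells_ok p q a vs 0 vs"
    using cert unfolding certificate_def by blast+
  have \<beta>1: "1 < \<beta>" using ce(1) \<beta>(1) by linarith
  define N where "N = real (length vs) / 32"
  \<comment> \<open>The margin by which the support exceeds the interval of possible differences serves as the initial distance.\<close>
  define c where "c = N - 1 / (\<beta> - 1)"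
  define \<rho> where "\<rho> = real_of_int a / 1000"
  have c: "0 < c"
  proof -
    have "real_of_int 3200 < real_of_int ((p - 100) * int (length vs))" using ce(3) by (simp only: of_int_less_iff)
    then have "1 < (real_of_int p / 100 - 1) * N" by (simp add: N_def field_simps)
    also have "\<dots> \<le> (\<beta> - 1) * N" using \<beta>(1) by (intro mult_right_mono) (auto simp: N_def)
    finally show ?thesis using \<beta>1 by (simp add: c_def field_simps)
  qed
  have \<rho>0: "0 < \<rho>" using ce(4) by (simp add: \<rho>_def)
  have \<rho>_le: "\<rho> \<le> \<beta> powr - 0.82"
  proof -
    have "real_of_int (a ^ 50 * q ^ 41) \<le> real_of_int (1000 ^ 50 * 100 ^ 41)"
      using ce(5) by (simp only: of_int_le_iff)
    then have "\<rho> ^ 50 * (real_of_int q / 100) ^ 41 \<le> 1"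
      by (simp add: \<rho>_def power_divide)
    moreover have "\<rho> ^ 50 * \<beta> ^ 41 \<le> \<rho> ^ 50 * (real_of_int q / 100) ^ 41"
      using \<beta>(2) \<beta>1 \<rho>0 by (intro mult_left_mono power_mono) auto
    ultimately have "\<rho> ^ 50 \<le> 1 / \<beta> ^ 41" using \<beta>1 by (simp add: field_simps)
    also have "\<dots> = \<beta> powr (- real 41)"
      using \<beta>1 by (simp only: powr_minus powr_realpow divide_inverse)
    also have "\<dots> = (\<beta> powr - 0.82) ^ 50"
      using \<beta>1 by (subst powr_power) simp_all
    finally have "\<rho> ^ 50 \<le> (\<beta> powr - 0.82) ^ 50" .
    then show ?thesis using power_mono_iff[of \<rho> "\<beta> powr - 0.82" 50] \<rho>0 by simp
  qed
  have "near coin_space (digit_sum \<beta>) 0 (c / \<beta> ^ n) \<le> ennreal (step_function vs 0 * (\<beta> powr - 0.82) ^ n)" for n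
  proof -
    have "near coin_space (digit_sum \<beta>) 0 (c / \<beta> ^ n) \<le> ennreal (\<rho> ^ n * step_function vs 0)"
    proof (rule near_digit_sum_decay[OF \<beta>1])
      show "0 \<le> step_function vs y" for y
        using lookup_nonneg[OF ce(6)] by (simp add: step_function_def)
      show "1 \<le> step_function vs y" if "\<bar>y\<bar> < 1 / (\<beta> - 1) + c" for y
      proof -
        have "32 * \<bar>y\<bar> < real_of_int (int (length vs))" using that by (simp add: c_def N_def)
        then have "\<lfloor>32 * \<bar>y\<bar>\<rfloor> < int (length vs)" by (simp only: floor_less_iff)
        then show ?thesis using lookup_ge_one[OF ce(6)] by (simp add: step_function_def)
      qed
    qed (use \<rho>0 certificate_supersolution[OF cert \<beta>] in \<open>auto simp: \<rho>_def\<close>)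
    also have "\<rho> ^ n * step_function vs 0 \<le> step_function vs 0 * (\<beta> powr - 0.82) ^ n"
      using \<rho>0 \<rho>_le lookup_nonneg[OF ce(6)]
      by (subst mult.commute, intro mult_left_mono power_mono) (auto simp: step_function_def)
    finally show ?thesis by (simp add: ennreal_leI)
  qed
  then show ?thesis
    by (rule near_power_bound[OF \<beta>1 c, rotated 2]) (use lookup_nonneg[OF ce(6)] that in \<open>auto simp: step_function_def\<close>)
qed

section \<open>The bound for all parameters\<close>
text \<open>The entries are the least nonincreasing positive integer solutions of the inequalities, found by iterating the averaging
  operator from the constant list 1. Such a solution exists when the operator, made monotone by taking running
  maxima, has spectral radius below \<open>a / 1000\<close>; the parameter intervals are about as long as this permits.\<close>
lemma certificate_141: "certificate 141 147 729
    [702, 702, 702, 697, 697, 690, 690, 689, 673, 673, 658, 644, 641, 614, 614, 583, 570, 557,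
     530, 525, 500, 488, 464, 445, 439, 408, 400, 377, 367, 353, 327, 318, 293, 285, 266, 243,
     232, 211, 203, 189, 177, 162, 146, 140, 123, 119, 107, 96, 88, 75, 72, 67, 57, 51, 43, 42,
     38, 31, 26, 23, 20, 15, 15, 14, 9, 8, 6, 6, 5, 3, 3, 2, 2, 2, 1, 1, 1, 1, 1]"
  by code_simp

lemma certificate_147: "certificate 147 153 705
    [164, 164, 164, 163, 161, 160, 160, 157, 156, 153, 149, 147, 144, 140, 136, 129, 129, 125,
     120, 117, 110, 106, 99, 99, 93, 90, 85, 81, 75, 72, 66, 64, 56, 56, 53, 49, 45, 39, 39,
     35, 33, 29, 27, 24, 21, 20, 19, 14, 14, 12, 11, 10, 8, 8, 5, 5, 4, 4, 3, 2, 2, 2, 1, 1, 1,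
     1, 1, 1, 1]"
  by code_simp

lemma certificate_153: "certificate 153 160 680
    [128, 128, 128, 128, 127, 127, 125, 123, 121, 119, 117, 116, 111, 107, 103, 102, 98, 94,
     90, 84, 83, 78, 75, 70, 68, 64, 62, 57, 55, 50, 48, 45, 42, 37, 34, 31, 28, 27, 24, 22,
     19, 18, 16, 14, 12, 11, 9, 9, 7, 6, 5, 4, 4, 3, 2, 2, 2, 1, 1, 1, 1]"
  by code_simp

lemma certificate_160: "certificate 160 169 650
    [142, 142, 142, 141, 140, 139, 135, 135, 133, 128, 125, 123, 117, 115, 110, 107, 102, 97,
     95, 88, 82, 80, 75, 73, 68, 62, 60, 55, 52, 47, 43, 39, 35, 33, 29, 27, 24, 22, 20, 17,
     14, 13, 11, 10, 8, 6, 5, 4, 4, 2, 2, 1, 1, 1]"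
  by code_simp

lemma certificate_169: "certificate 169 179 620
    [394, 394, 394, 392, 384, 384, 371, 371, 365, 345, 343, 330, 323, 311, 296, 279, 263, 250,
     237, 221, 217, 200, 187, 175, 165, 149, 141, 128, 113, 101, 96, 88, 76, 71, 61, 52, 46,
     39, 31, 29, 21, 16, 13, 9, 6, 3, 2]"
  by code_simp

lemma certificate_179: "certificate 179 190 590
    [181, 181, 181, 179, 175, 175, 170, 166, 161, 151, 151, 142, 139, 129, 126, 123, 113, 107,
     98, 92, 89, 81, 74, 64, 64, 59, 54, 48, 42, 39, 35, 28, 25, 21, 18, 15, 11, 8, 5, 4, 2]"
  by code_simp

lemma certificate_190: "certificate 190 200 566
    [42, 42, 42, 41, 41, 39, 38, 38, 36, 35, 31, 31, 31, 31, 29, 26, 24, 23, 21, 19, 17, 17,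
     16, 14, 14, 12, 11, 9, 8, 7, 6, 5, 4, 3, 2, 1]"
  by code_simp

lemma near_bound_large:
  assumes \<beta>: "1.41 \<le> \<beta>" "\<beta> \<le> 2"
  obtains K where "\<And>r. 0 < r \<Longrightarrow> near coin_space (digit_sum \<beta>) 0 r \<le> ennreal (K * r powr 0.82)"
proof -
  have "\<beta> \<le> 1.47 \<or> 1.47 \<le> \<beta> \<and> \<beta> \<le> 1.53 \<or> 1.53 \<le> \<beta> \<and> \<beta> \<le> 1.6 \<or> 1.6 \<le> \<beta> \<and> \<beta> \<le> 1.69
      \<or> 1.69 \<le> \<beta> \<and> \<beta> \<le> 1.79 \<or> 1.79 \<le> \<beta> \<and> \<beta> \<le> 1.9 \<or> 1.9 \<le> \<beta>" by linarith
  then consider "\<beta> \<in> {1.41..1.47}" | "\<beta> \<in> {1.47..1.53}" | "\<beta> \<in> {1.53..1.6}" | "\<beta> \<in> {1.6..1.69}"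
    | "\<beta> \<in> {1.69..1.79}" | "\<beta> \<in> {1.79..1.9}" | "\<beta> \<in> {1.9..2}"
    using \<beta> unfolding atLeastAtMost_iff by blast
  then show thesis
  proof cases
    case 1 then show ?thesis using near_bound_of_certificate[OF certificate_141, of \<beta>] that by auto
  next
    case 2 then show ?thesis using near_bound_of_certificate[OF certificate_147, of \<beta>] that by auto
  next
    case 3 then show ?thesis using near_bound_of_certificate[OF certificate_153, of \<beta>] that by auto
  next
    case 4 then show ?thesis using near_bound_of_certificate[OF certificate_160, of \<beta>] that by auto
  next
    case 5 then show ?thesis using near_bound_of_certificate[OF certificate_169, of \<beta>] that by auto
  next
    case 6 then show ?thesis using near_bound_of_certificate[OF certificate_179, of \<beta>] that by auto
  next
    case 7 then show ?thesis using near_bound_of_certificate[OF certificate_190, of \<beta>] that by auto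
  qed
qed

text \<open>Repeated squaring leads from any \<open>\<beta> > 1\<close> into \<open>[1.41, 2)\<close>, because \<open>1.41\<^sup>2 < 2\<close>.\<close>
lemma near_bound:
  assumes \<beta>: "1 < \<beta>" "\<beta> < 2"
  obtains K where "\<And>r. 0 < r \<Longrightarrow> near coin_space (digit_sum \<beta>) 0 r \<le> ennreal (K * r powr 0.82)"
proof -
  have ind: "\<exists>K. \<forall>r>0. near coin_space (digit_sum \<beta>) 0 r \<le> ennreal (K * r powr 0.82)"
    if "1 < \<beta>" "\<beta> < 2" "1.41 \<le> \<beta> ^ (2 ^ n)" for n \<beta>
    using that
  proof (induction n arbitrary: \<beta>)
    case 0
    then show ?case using near_bound_large[of \<beta>] by (metis less_imp_le power_0 power_one_right)
  next
    case (Suc n)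
    show ?case
    proof (cases "1.41 \<le> \<beta>")
      case True
      then show ?thesis using near_bound_large[of \<beta>] Suc.prems by (metis less_imp_le)
    next
      case False
      have "\<beta>\<^sup>2 \<le> 1.41\<^sup>2" using False Suc.prems by (intro power_mono) auto
      then have "\<beta>\<^sup>2 < 2" by (simp add: power2_eq_square)
      moreover have "1 < \<beta>\<^sup>2" using Suc.prems by (simp add: one_less_power)
      moreover have "1.41 \<le> (\<beta>\<^sup>2) ^ (2 ^ n)" using Suc.prems(3) by (simp add: power_mult[symmetric])
      ultimately obtain K where K: "\<And>r. 0 < r \<Longrightarrow> near coin_space (digit_sum (\<beta>\<^sup>2)) 0 r \<le> ennreal (K * r powr 0.82)"
        using Suc.IH[of "\<beta>\<^sup>2"] by blast
      have "near coin_space (digit_sum \<beta>) 0 r \<le> ennreal (2 * K * 2 powr 0.82 * r powr 0.82)" if r: "0 < r" for r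
      proof -
        have "near coin_space (digit_sum \<beta>) 0 r \<le> 2 * near coin_space (digit_sum (\<beta>\<^sup>2)) 0 (2 * r)"
          by (rule near_digit_sum_square[OF Suc.prems(1) r])
        also have "\<dots> \<le> 2 * ennreal (K * (2 * r) powr 0.82)"
          using r by (intro mult_left_mono K) auto
        also have "\<dots> = ennreal (2 * (K * (2 * r) powr 0.82))" by (simp add: ennreal_mult')
        also have "2 * (K * (2 * r) powr 0.82) = 2 * K * 2 powr 0.82 * r powr 0.82"
          using r by (simp add: powr_mult)
        finally show ?thesis .
      qed
      then show ?thesis by blast
    qed
  qed
  obtain m where "1.41 < \<beta> ^ m" using real_arch_pow[OF \<beta>(1)] by blast
  also have "\<beta> ^ m \<le> \<beta> ^ (2 ^ m)" using \<beta> by (intro power_increasing) (auto intro: less_imp_le)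
  finally show ?thesis using ind[OF \<beta>, of m] that by force
qed

theorem theorem1p4:
  fixes \<beta> :: real
  assumes "1 < \<beta>" and "\<beta> < 2"
  shows "exact_dim (bernoulli_convolution \<beta>) \<ge> 0.82"
proof -
  let ?\<mu> = "bernoulli_convolution \<beta>"
  have ps: "prob_space ?\<mu>" by (rule prob_space_bernoulli_convolution)
  then have fm: "finite_measure ?\<mu>" by (simp add: prob_space_def)
  have sets: "sets ?\<mu> = sets borel" by (simp add: bernoulli_convolution_def)
  obtain \<alpha> where \<alpha>: "has_exact_dim ?\<mu> \<alpha>"
    using bernoulli_convolution_exact_dimensional[OF assms(1)] by blast
  obtain K where K: "\<And>r. 0 < r \<Longrightarrow> near coin_space (digit_sum \<beta>) 0 r \<le> ennreal (K * r powr 0.82)"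
    using near_bound[OF assms] by blast
  have "(\<integral>\<^sup>+y. ennreal (measure ?\<mu> (ball y r)) \<partial>?\<mu>) \<le> ennreal (K * r powr 0.82)" if r: "0 < r" for r
  proof -
    have [measurable]: "(\<lambda>y. measure ?\<mu> (ball y r)) \<in> borel_measurable borel"
      using measurable_measure_ball[OF fm sets, of UNIV] by simp
    have "(\<integral>\<^sup>+y. ennreal (measure ?\<mu> (ball y r)) \<partial>?\<mu>) = (\<integral>\<^sup>+\<omega>. ennreal (measure ?\<mu> (ball (digit_sum \<beta> \<omega>) r)) \<partial>coin_space)"
    proof -
      have "(\<integral>\<^sup>+y. g y \<partial>?\<mu>) = (\<integral>\<^sup>+\<omega>. g (digit_sum \<beta> \<omega>) \<partial>coin_space)" if "g \<in> borel_measurable borel" for g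
        unfolding bernoulli_convolution_def by (rule nn_integral_distr) (use that in auto)
      then show ?thesis by simp
    qed
    also have "\<dots> = near coin_space (digit_sum \<beta>) 0 r"
      unfolding near_def
    proof (rule nn_integral_cong)
      fix \<omega>
      have [measurable]: "{\<eta> \<in> space coin_space. digit_sum \<beta> \<eta> \<in> ball (digit_sum \<beta> \<omega>) r} \<in> sets coin_space"
        unfolding mem_ball by measurable
      have "measure ?\<mu> (ball (digit_sum \<beta> \<omega>) r) = coin.prob {\<eta> \<in> space coin_space. digit_sum \<beta> \<eta> \<in> ball (digit_sum \<beta> \<omega>) r}"
        unfolding bernoulli_convolution_def by (subst measure_distr) (auto simp: vimage_def)
      also have "ennreal \<dots> = (\<integral>\<^sup>+\<eta>. indicator {\<eta> \<in> space coin_space. digit_sum \<beta> \<eta> \<in> ball (digit_sum \<beta> \<omega>) r} \<eta> \<partial>coin_space)"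
        unfolding coin.emeasure_eq_measure[symmetric] by (rule nn_integral_indicator[symmetric]) measurable
      also have "\<dots> = (\<integral>\<^sup>+\<eta>. indicator {-r<..<r} (0 + digit_sum \<beta> \<omega> - digit_sum \<beta> \<eta>) \<partial>coin_space)"
        by (intro nn_integral_cong) (auto simp: ball_real_eq split: split_indicator)
      finally show "ennreal (measure ?\<mu> (ball (digit_sum \<beta> \<omega>) r)) =
        (\<integral>\<^sup>+\<eta>. indicator {-r<..<r} (0 + digit_sum \<beta> \<omega> - digit_sum \<beta> \<eta>) \<partial>coin_space)" .
    qed
    finally show ?thesis using K[OF r] by simp
  qed
  then have "0.82 \<le> \<alpha>" by (rule exact_dim_lower_bound_by_correlation[OF ps sets \<alpha>])
  then show ?thesis using exact_dim_eqI[OF ps \<alpha>] by simp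
qed

end
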